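(* Let $a,\ell_1,\ell_2,\ldots,\ell_k$ be positive integers such that $2\leq a\leq \ell_1\leq\ell_2\leq\cdots\leq\ell_k$ and $2^a-a-1\geq k$. Let $\sigma$ be the layered permutation whose layer sequence is $(\underbrace{1,1,\ldots,1}_{a},\ell_1,\ell_2,\ldots,\ell_k)$ (i.e. with block sequence $(\widehat{a},\ell_1,\ldots,\ell_k)$: an antilayer of length $a$ followed by layers of lengths $\ell_1,\ldots,\ell_k$). Then \[ p(\sigma) = \frac{|\sigma|!}{|\sigma|^{|\sigma|}}\,\frac{a^a}{a!}\prod_{i=1}^k\frac{\ell_i^{\ell_i}}{\ell_i!}, \] where $|\sigma| = a+\sum_{i=1}^k\ell_i$.
   Context: A permutation of $[n]=\{1,\ldots,n\}$ is written $(\sigma(1)\sigma(2)\cdots\sigma(n))$ and $|\sigma|=n$; $\mathfrak{S}_n$ is the set of permutations of $[n]$. For $\{i_1<\cdots<i_m\}\subset[n]$, $\sigma[\{i_1,\ldots,i_m\}]$ is the unique $\tau\in\mathfrak{S}_m$ with $\sigma(i_j)<\sigma(i_k)\iff\tau(j)<\tau(k)$. For $\tau\in\mathfrak{S}_m$, $\sigma\in\mathfrak{S}_n$, $m\le n$, the density $p(\tau,\sigma)$ is $\binom{n}{m}^{-1}$ times the number of $m$-subsets $A\subset[n]$ with $\sigma[A]=\tau$ (and $0$ if $m>n$). The packing density is $p(\tau)=\lim_{N\to\infty}\max\{p(\tau,\sigma):\sigma\in\mathfrak{S}_N\}$ (this limit exists). A permutation is layered with layer sequence $(r_1,\ldots,r_m)$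 (positive integers summing to $n$) if it is the concatenation of $m$ decreasing runs of consecutive values, of lengths $r_1,\ldots,r_m$, with all values in each run smaller than all values in later runs; e.g. layer sequence $(2,1,3)$ gives $(213654)$. An antilayer is a maximal contiguous nonempty sequence of layers of length $1$. *)

theory Defs
  imports Complex_Main "HOL-Combinatorics.Permutations"
begin

text \<open>
  Permutations of \<open>[n]\<close> are functions \<open>\<sigma> :: nat \<Rightarrow> nat\<close> with \<open>\<sigma> permutes {1..n}\<close>, so they are
  the identity outside \<open>{1..n}\<close>. Such a function does not determine its size (the identity
  permutes every \<open>{1..n}\<close>), hence the size is an explicit argument below.
\<close>

text \<open>\<open>nth_elem A j\<close> is the element \<open>i\<^sub>j\<close> of a finite set \<open>A = {i\<^sub>1 < \<dots> < i\<^sub>m}\<close>, for \<open>1 \<le> j \<le> m\<close>.\<close>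

definition nth_elem :: "nat set \<Rightarrow> nat \<Rightarrow> nat" where
  "nth_elem A j = sorted_list_of_set A ! (j - 1)"

definition pattern :: "(nat \<Rightarrow> nat) \<Rightarrow> nat set \<Rightarrow> (nat \<Rightarrow> nat)" where
  "pattern \<sigma> A = (THE \<tau>. \<tau> permutes {1..card A} \<and>
     (\<forall>j\<in>{1..card A}. \<forall>k\<in>{1..card A}.
        \<sigma> (nth_elem A j) < \<sigma> (nth_elem A k) \<longleftrightarrow> \<tau> j < \<tau> k))"

text \<open>For \<open>m > n\<close> there is no \<open>m\<close>-subset, so the density is \<open>0\<close> as it should be.\<close>

definition pattern_density :: "nat \<Rightarrow> (nat \<Rightarrow> nat) \<Rightarrow> nat \<Rightarrow> (nat \<Rightarrow> nat) \<Rightarrow> real" where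
  "pattern_density m \<tau> n \<sigma> =
     real (card {A. A \<subseteq> {1..n} \<and> card A = m \<and> pattern \<sigma> A = \<tau>}) / real (n choose m)"

definition packing_density :: "nat \<Rightarrow> (nat \<Rightarrow> nat) \<Rightarrow> real" where
  "packing_density m \<tau> =
     lim (\<lambda>N. Max {pattern_density m \<tau> N \<sigma> | \<sigma>. \<sigma> permutes {1..N}})"

text \<open>\<open>layer_word s rs\<close> lists the values of the layers \<open>rs\<close> when \<open>s\<close> values are already used up.\<close>

primrec layer_word :: "nat \<Rightarrow> nat list \<Rightarrow> nat list" where
  "layer_word s [] = []"
| "layer_word s (r # rs) = rev [s + 1..<s + r + 1] @ layer_word (s + r) rs"

definition has_layer_sequence :: "(nat \<Rightarrow> nat) \<Rightarrow> nat list \<Rightarrow> bool" where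
  "has_layer_sequence \<sigma> rs \<longleftrightarrow> (\<forall>r\<in>set rs. r > 0) \<and>
     \<sigma> permutes {1..sum_list rs} \<and> map \<sigma> [1..<sum_list rs + 1] = layer_word 0 rs"

lemma "layer_word 0 [2, 1, 3] = [2, 1, 3, 6, 5, 4]"
  by (simp add: upt_rec numeral_eq_Suc)


text \<open>The description in \<^const>\<open>pattern\<close> determines a unique permutation.\<close>

lemma strict_mono_permutes_id:
  fixes f :: "nat \<Rightarrow> nat"
  assumes f: "f permutes {1..m}"
    and mono: "\<And>j k. j \<in> {1..m} \<Longrightarrow> k \<in> {1..m} \<Longrightarrow> j < k \<Longrightarrow> f j < f k"
  shows "f = id"
proof -
  have "f j \<ge> j" if "j \<in> {1..m}" for j
    using that
  proof (induction j)
    case (Suc j)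
    show ?case
    proof (cases "j = 0")
      case True
      then show ?thesis using permutes_in_image[OF f, of 1] Suc.prems by auto
    next
      case False
      with Suc mono[of j "Suc j"] show ?thesis by auto
    qed
  qed simp
  moreover have "f j = j" if "j \<notin> {1..m}" for j
    using f that by (simp add: permutes_not_in)
  ultimately have "\<And>j. j \<in> {1..m} \<Longrightarrow> j \<le> f j" by blast
  with permutes_natset_ge[OF f] show ?thesis by blast
qed

lemma nth_elem_bij:
  assumes "finite A"
  shows "bij_betw (nth_elem A) {1..card A} A"
proof -
  have "bij_betw (\<lambda>j. j - 1) {1..card A} {..<card A}"
    by (rule bij_betwI[where g = Suc]) auto
  moreover have "bij_betw ((!) (sorted_list_of_set A)) {..<card A} A"
    using assms by (intro bij_betw_nth) auto
  ultimately have "bij_betw ((!) (sorted_list_of_set A) \<circ> (\<lambda>j. j - 1)) {1..card A} A"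
    by (rule bij_betw_trans)
  moreover have "(!) (sorted_list_of_set A) \<circ> (\<lambda>j. j - 1) = nth_elem A"
    by (rule ext) (simp add: nth_elem_def)
  ultimately show ?thesis by metis
qed

lemma pattern_ex1:
  fixes \<sigma> :: "nat \<Rightarrow> nat"
  assumes "finite A" "inj_on \<sigma> A"
  shows "\<exists>!\<tau>. \<tau> permutes {1..card A} \<and>
     (\<forall>j\<in>{1..card A}. \<forall>k\<in>{1..card A}.
        \<sigma> (nth_elem A j) < \<sigma> (nth_elem A k) \<longleftrightarrow> \<tau> j < \<tau> k)"
proof -
  define m where "m = card A"
  define g where "g j = \<sigma> (nth_elem A j)" for j
  have inj: "inj_on g {1..m}"
  proof -
    have "g = \<sigma> \<circ> nth_elem A" by (auto simp: g_def)
    then show ?thesis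
      using nth_elem_bij[OF assms(1)] assms(2) comp_inj_on[of "nth_elem A" "{1..m}" \<sigma>]
      by (simp add: bij_betw_def m_def)
  qed
  define t where "t j = (if j \<in> {1..m} then card {i\<in>{1..m}. g i \<le> g j} else j)" for j
  have t_mono: "g j < g k \<longleftrightarrow> t j < t k" if jk: "j \<in> {1..m}" "k \<in> {1..m}" for j k
  proof -
    have t_less: "t j < t k" if "g j < g k" "j \<in> {1..m}" "k \<in> {1..m}" for j k
    proof -
      have "{i\<in>{1..m}. g i \<le> g j} \<subseteq> {i\<in>{1..m}. g i \<le> g k}"
        using that(1) by auto
      moreover have "k \<in> {i\<in>{1..m}. g i \<le> g k} - {i\<in>{1..m}. g i \<le> g j}"
        using that by auto
      ultimately have "{i\<in>{1..m}. g i \<le> g j} \<subset> {i\<in>{1..m}. g i \<le> g k}"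
        by blast
      then have "card {i\<in>{1..m}. g i \<le> g j} < card {i\<in>{1..m}. g i \<le> g k}"
        by (intro psubset_card_mono) auto
      then show ?thesis unfolding t_def if_P[OF that(2)] if_P[OF that(3)] .
    qed
    show ?thesis
    proof (cases "g j" "g k" rule: linorder_cases)
      case less
      then show ?thesis using t_less[OF less jk] by simp
    next
      case equal
      then have "j = k" by (rule inj_onD[OF inj _ jk])
      then show ?thesis by simp
    next
      case greater
      then have "t k < t j" using t_less jk by blast
      then show ?thesis using greater by simp
    qed
  qed
  have t_inj: "inj_on t {1..m}"
  proof (rule inj_onI)
    fix j k assume jk: "j \<in> {1..m}" "k \<in> {1..m}" "t j = t k"
    then have "g j = g k"
      using t_mono[of j k] t_mono[of k j] by linarith
    then show "j = k" by (rule inj_onD[OF inj _ jk(1,2)])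
  qed
  have t_in: "t ` {1..m} \<subseteq> {1..m}"
  proof
    fix y assume "y \<in> t ` {1..m}"
    then obtain j where j: "j \<in> {1..m}" "y = card {i\<in>{1..m}. g i \<le> g j}"
      by (auto simp: t_def)
    have "card {i\<in>{1..m}. g i \<le> g j} \<le> card {1..m}" by (rule card_mono) auto
    moreover have "card {i\<in>{1..m}. g i \<le> g j} > 0" using j(1) by (subst card_gt_0_iff) auto
    ultimately show "y \<in> {1..m}" using j by simp
  qed
  have t_perm: "t permutes {1..m}"
  proof (rule bij_imp_permutes)
    show "bij_betw t {1..m} {1..m}"
      using t_inj endo_inj_surj[OF _ t_in t_inj] by (simp add: bij_betw_def)
    show "t x = x" if "x \<notin> {1..m}" for x
      unfolding t_def by (rule if_not_P) (rule that)
  qed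
  have uniq: "u = t"
    if u: "u permutes {1..m}" "\<And>j k. j \<in> {1..m} \<Longrightarrow> k \<in> {1..m} \<Longrightarrow> g j < g k \<longleftrightarrow> u j < u k" for u
  proof -
    have "u \<circ> inv t = id"
    proof (rule strict_mono_permutes_id)
      show "u \<circ> inv t permutes {1..m}"
        by (rule permutes_compose[OF permutes_inv[OF t_perm] u(1)])
      fix j k assume jk: "j \<in> {1..m}" "k \<in> {1..m}" "j < k"
      then have "inv t j \<in> {1..m}" "inv t k \<in> {1..m}"
        using permutes_in_image[OF permutes_inv[OF t_perm]] by blast+
      then show "(u \<circ> inv t) j < (u \<circ> inv t) k"
        using u(2)[of "inv t j" "inv t k"] t_mono[of "inv t j" "inv t k"] jk
          permutes_inverses(1)[OF t_perm] by simp
    qed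
    show "u = t"
    proof
      fix x
      show "u x = t x"
        using fun_cong[OF \<open>u \<circ> inv t = id\<close>, of "t x"] permutes_inverses(2)[OF t_perm] by simp
    qed
  qed
  show ?thesis
    unfolding m_def[symmetric] g_def[symmetric]
  proof (rule ex1I)
    show "t permutes {1..m} \<and>
        (\<forall>j\<in>{1..m}. \<forall>k\<in>{1..m}. g j < g k \<longleftrightarrow> t j < t k)"
      using t_perm t_mono by blast
  next
    fix u
    assume u: "u permutes {1..m} \<and>
        (\<forall>j\<in>{1..m}. \<forall>k\<in>{1..m}. g j < g k \<longleftrightarrow> u j < u k)"
    show "u = t" by (rule uniq) (use u in blast)+
  qed
qed


text \<open>Every sequence of positive integers is the layer sequence of a unique permutation.\<close>

lemma layer_word_props:
  "length (layer_word s rs) = sum_list rs \<and> distinct (layer_word s rs) \<and>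
   set (layer_word s rs) = {s + 1..s + sum_list rs}"
proof (induction rs arbitrary: s)
  case (Cons r rs)
  have "{s + 1..s + r} \<union> {s + r + 1..s + r + sum_list rs} = {s + 1..s + (r + sum_list rs)}"
    by auto
  moreover have "set [s + 1..<s + r + 1] = {s + 1..s + r}"
    by (simp add: atLeastLessThanSuc_atLeastAtMost del: upt_Suc)
  moreover have "{s + 1..s + r} \<inter> {s + r + 1..s + r + sum_list rs} = {}"
    by auto
  ultimately show ?case
    using Cons.IH[of "s + r"] by (simp del: upt_Suc add: atLeastLessThanSuc_atLeastAtMost)
qed simp

lemma has_layer_sequence_ex1:
  assumes "\<forall>r\<in>set rs. r > 0"
  shows "\<exists>!\<sigma>. has_layer_sequence \<sigma> rs"
proof -
  define n where "n = sum_list rs"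
  define w where "w = layer_word 0 rs"
  have w: "length w = n" "distinct w" "set w = {1..n}"
    using layer_word_props[of 0 rs] by (auto simp: n_def w_def)
  define t where "t i = (if i \<in> {1..n} then w ! (i - 1) else i)" for i
  have map_t: "map t [1..<n + 1] = w"
    using w(1) by (intro nth_equalityI) (auto simp: t_def simp del: upt_Suc)
  have "inj_on t {1..n}"
    using w by (auto simp: inj_on_def t_def nth_eq_iff_index_eq)
  moreover have "t ` {1..n} = {1..n}"
    using arg_cong[OF map_t, of set] w(3)
    by (simp add: atLeastLessThanSuc_atLeastAtMost del: upt_Suc)
  ultimately have "t permutes {1..n}"
    by (intro bij_imp_permutes) (auto simp: bij_betw_def t_def)
  moreover have "u = t" if "u permutes {1..n}" "map u [1..<n + 1] = w" for u
  proof
    fix i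
    show "u i = t i"
    proof (cases "i \<in> {1..n}")
      case True
      then have "i \<in> set [1..<n + 1]" by auto
      with that(2) map_t show ?thesis by (metis map_eq_conv)
    next
      case False
      with that(1) show ?thesis unfolding t_def by (auto dest: permutes_not_in)
    qed
  qed
  ultimately show ?thesis
    using assms map_t unfolding has_layer_sequence_def n_def[symmetric] w_def[symmetric]
    by blast
qed

end

theory Submission imports Defs begin

text \<open>
  Give every position \<open>v\<close> of a permutation \<open>\<pi>\<close> a weight \<open>w v \<ge> 0\<close> and blow it up to a decreasing layer
  of that weight. The weighted number of copies of \<open>\<sigma>\<close> is convex along any exchange of weight between
  two positions forming an inversion, so all weight can be moved to a set of positions without
  inversions. What remains is to bound a monomial quasisymmetric polynomial with exponent sequence
  \<open>1, \<dots>, 1, \<ell>\<^sub>1, \<dots>, \<ell>\<^sub>k\<close> on a list of layer weights of given sum.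

  There the layers can be sorted increasingly, and a mass \<open>A\<close> of infinitesimal layers (the antilayer)
  is kept in front of them. While there are more than \<open>k\<close> layers, let \<open>y\<close> be the \<open>k\<close>-th largest one.
  If \<open>A \<le> y\<close>, dissolving the smallest layer into the antilayer does not decrease the
  polynomial; if \<open>y < A\<close>, neither does merging \<open>y\<close> with its predecessor. Both
  steps rest on \<open>k \<le> 2\<^sup>a - a - 1\<close>. With exactly \<open>k\<close> layers left, the bound is weighted AM-GM. It is
  attained asymptotically by layered permutations with proportional layers.
\<close>

section \<open>Monomial quasisymmetric polynomials\<close>

text \<open>Counting maps that may send entries of one layer to a common position, instead of
  counting subsets, gives an upper bound valid for every \<open>N\<close> with no error term. On
  positions without inversions such a map is constant on layers and increasing across them, which is
  why quasisymmetric polynomials appear. The obstacle is the antilayer: \<open>m\<close> equal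
  pieces of total weight \<open>A\<close> contribute \<open>(m choose a) * (A / m) ^ a\<close>,
  which stays below \<open>A ^ a / fact a\<close> for \<open>a \<ge> 2\<close>, so cutting finer
  always helps. Tracking the limit mass \<open>A\<close> separately removes this. The number
  \<open>2 ^ a - a - 1\<close> counts the subsets of an \<open>a\<close>-set with at least two
  elements. When a layer \<open>w\<close> is dissolved, the terms of \<open>(A + w) ^ a\<close>
  containing \<open>w\<close> at most once match choices that skip \<open>w\<close> or use it as a
  singleton; the other \<open>2 ^ a - a - 1\<close> products are gain. Lost are the choices where
  \<open>w\<close> plays the first layer of \<open>ls\<close>. Such a choice can use one of the
  \<open>k\<close> largest layers instead, and each resulting choice arises at most \<open>k\<close>
  times. Comparing \<open>A\<close> with \<open>y\<close> decides whether this exchange or merging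
  is affordable.\<close>

fun mqs :: "nat list \<Rightarrow> real list \<Rightarrow> real" where
  "mqs [] ws = 1"
| "mqs (e # es) [] = 0"
| "mqs (e # es) (w # ws) = mqs (e # es) ws + w ^ e * mqs es ws"

lemma mqs_nonneg:
  assumes "\<And>w. w \<in> set ws \<Longrightarrow> 0 \<le> w"
  shows "0 \<le> mqs es ws"
  using assms by (induction es ws rule: mqs.induct) auto

lemma mqs_eq_0: "length ws < length es \<Longrightarrow> mqs es ws = 0"
  by (induction es ws rule: mqs.induct) auto

section \<open>Sorting the layers by weight\<close>

lemma power_swap_le:
  fixes x y :: real
  assumes "0 \<le> y" "y \<le> x" "e \<le> f"
  shows "x ^ e * y ^ f \<le> y ^ e * x ^ f"
proof -
  have f: "z ^ f = z ^ e * z ^ (f - e)" for z :: real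
    using assms(3) by (simp flip: power_add)
  have "y ^ (f - e) \<le> x ^ (f - e)" using assms by (intro power_mono)
  then have "(x ^ e * y ^ e) * y ^ (f - e) \<le> (x ^ e * y ^ e) * x ^ (f - e)"
    using assms by (intro mult_left_mono) auto
  then show ?thesis by (simp add: f mult_ac)
qed

text \<open>Only choices using both \<open>x\<close> and \<open>y\<close> depend on their order, and
  for nondecreasing exponents the larger weight should carry the later exponent.\<close>

lemma mqs_swap_le:
  assumes "sorted es" "0 \<le> y" "y \<le> x" "\<And>w. w \<in> set ws \<Longrightarrow> 0 \<le> w"
  shows "mqs es (x # y # ws) \<le> mqs es (y # x # ws)"
proof (cases es)
  case (Cons e es')
  show ?thesis
  proof (cases es')
    case (Cons f es'')
    have "x ^ e * y ^ f * mqs es'' ws \<le> y ^ e * x ^ f * mqs es'' ws"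
      using assms \<open>es = e # es'\<close> Cons by (intro mult_right_mono power_swap_le mqs_nonneg) auto
    then show ?thesis by (simp add: \<open>es = e # es'\<close> Cons algebra_simps)
  qed (simp add: Cons)
qed simp

lemma mqs_insort_le:
  assumes "sorted es" "0 \<le> x" "\<And>w. w \<in> set ws \<Longrightarrow> 0 \<le> w"
  shows "mqs es (x # ws) \<le> mqs es (insort x ws)"
  using assms
proof (induction ws arbitrary: es)
  case (Cons y ws)
  show ?case
  proof (cases "x \<le> y")
    case False
    then have "mqs es (x # y # ws) \<le> mqs es (y # x # ws)"
      using Cons.prems by (intro mqs_swap_le) auto
    also have "\<dots> \<le> mqs es (y # insort x ws)"
    proof (cases es)
      case (Cons e es')
      then have "mqs (e # es') (x # ws) \<le> mqs (e # es') (insort x ws)"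
        "mqs es' (x # ws) \<le> mqs es' (insort x ws)"
        using Cons.prems by (intro Cons.IH; auto)+
      then show ?thesis
        using Cons.prems by (auto simp del: mqs.simps(3) simp add: mqs.simps(3)[of _ _ y] Cons
          intro!: add_mono mult_left_mono)
    qed simp
    finally show ?thesis using False by simp
  qed simp
qed simp

lemma mqs_sort_le:
  assumes "sorted es" "\<And>w. w \<in> set ws \<Longrightarrow> 0 \<le> w"
  shows "mqs es ws \<le> mqs es (sort ws)"
  using assms
proof (induction ws arbitrary: es)
  case (Cons w ws)
  have "mqs es (w # ws) \<le> mqs es (w # sort ws)"
  proof (cases es)
    case (Cons e es')
    then have "mqs (e # es') ws \<le> mqs (e # es') (sort ws)" "mqs es' ws \<le> mqs es' (sort ws)"
      using Cons.prems by (intro Cons.IH; auto)+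
    then show ?thesis
      using Cons.prems by (auto simp: Cons intro!: add_mono mult_left_mono)
  qed simp
  also have "\<dots> \<le> mqs es (insort w (sort ws))"
    using Cons.prems by (intro mqs_insort_le) auto
  finally show ?case by simp
qed simp

text \<open>
  A choice of layers for \<open>es\<close> misses one of the \<open>length es + 1\<close> largest layers; adding that layer
  gains a factor of at least \<open>z\<^sup>e\<close>, and each choice for \<open>e # es\<close> arises at most \<open>length es + 1\<close> times.
\<close>

lemma mqs_insert_layer:
  assumes "sorted (e # es)" "sorted us" "\<And>u. u \<in> set us \<Longrightarrow> 0 \<le> u"
    and "length es < length us" "0 \<le> z" "z \<le> us ! (length us - Suc (length es))"
  shows "z ^ e * mqs es us \<le> real (Suc (length es)) * mqs (e # es) us"
  using assms
proof (induction us arbitrary: e es z)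
  case (Cons u us)
  have u: "0 \<le> u" and us: "sorted us" "\<And>v. v \<in> set us \<Longrightarrow> 0 \<le> v" "\<And>v. v \<in> set us \<Longrightarrow> u \<le> v"
    using Cons.prems by auto
  have nn: "0 \<le> mqs es us" "0 \<le> mqs (e # es) us" for es e
    using us by (intro mqs_nonneg; simp)+
  have first: "z ^ e * mqs es us \<le>
      (if length es < length us then real (Suc (length es)) * mqs (e # es) us else u ^ e * mqs es us)"
  proof (cases "length es < length us")
    case True
    then have "(u # us) ! (length (u # us) - Suc (length es)) = us ! (length us - Suc (length es))"
      by (simp add: nth_Cons')
    then have "z ^ e * mqs es us \<le> real (Suc (length es)) * mqs (e # es) us"
      using True Cons.prems us by (intro Cons.IH) auto
    then show ?thesis using True by simp
  next
    case False
    then have "z \<le> u" using Cons.prems by (simp add: less_Suc_eq)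
    then show ?thesis using False nn Cons.prems by (auto intro!: mult_right_mono power_mono)
  qed
  show ?case
  proof (cases es)
    case Nil
    then show ?thesis using first zero_le_power[OF u, of e]
      by (cases us) auto
  next
    case es: (Cons f es')
    have len: "length es' < length us" using Cons.prems es by simp
    have last: "us ! (length us - Suc (length es')) = (u # us) ! (length (u # us) - Suc (length es'))"
      using len by (simp add: nth_Cons')
    \<comment> \<open>Choices where \<open>u\<close> carries \<open>f\<close>. If
      \<open>u \<le> z\<close>, exchanging exponents leaves \<open>z\<close> to be inserted with
      exponent \<open>f\<close>; otherwise \<open>u\<close> plays the part of the inserted weight.
      The factor \<open>Suc (length es')\<close> is \<open>length es\<close>, so together with one
      copy from \<open>first\<close> the total is \<open>length es + 1\<close>.\<close>
    have second: "z ^ e * (u ^ f * mqs es' us) \<le> u ^ e * (real (Suc (length es')) * mqs es us)"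
    proof (cases "u \<le> z")
      case True
      have "(u # us) ! (length (u # us) - Suc (length es))
          \<le> (u # us) ! (length (u # us) - Suc (length es'))"
        using Cons.prems(2) len es by (intro sorted_nth_mono) auto
      then have "z \<le> us ! (length us - Suc (length es'))"
        using last Cons.prems by linarith
      then have IH: "z ^ f * mqs es' us \<le> real (Suc (length es')) * mqs (f # es') us"
        using Cons.prems us len es by (intro Cons.IH) auto
      have "z ^ e * u ^ f \<le> u ^ e * z ^ f"
        using Cons.prems es u True by (intro power_swap_le) auto
      then have "z ^ e * u ^ f * mqs es' us \<le> u ^ e * z ^ f * mqs es' us"
        using nn by (intro mult_right_mono)
      also have "\<dots> \<le> u ^ e * (real (Suc (length es')) * mqs (f # es') us)"
        using IH u by (simp only: mult.assoc) (intro mult_left_mono; simp)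
      finally show ?thesis by (simp add: es mult.assoc)
    next
      case False
      have "u \<le> us ! (length us - Suc (length es'))"
        using us len by simp
      then have IH: "u ^ f * mqs es' us \<le> real (Suc (length es')) * mqs (f # es') us"
        using Cons.prems us len es u by (intro Cons.IH) auto
      have "z ^ e \<le> u ^ e" using False Cons.prems by (intro power_mono) auto
      then show ?thesis unfolding es
        using nn u by (intro mult_mono[OF _ IH]) auto
    qed
    have "z ^ e * mqs es (u # us) = z ^ e * mqs es us + z ^ e * (u ^ f * mqs es' us)"
      by (simp add: es algebra_simps)
    also have "\<dots> \<le> (real (Suc (length es)) * mqs (e # es) us + u ^ e * mqs es us)
        + u ^ e * (real (Suc (length es')) * mqs es us)"
    proof (intro add_mono second)
      show "z ^ e * mqs es us \<le> real (Suc (length es)) * mqs (e # es) us + u ^ e * mqs es us"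
      proof (cases "length es < length us")
        case True
        then show ?thesis
          using first mult_nonneg_nonneg[OF zero_le_power[OF u, of e] nn(1)[of es]] by simp
      next
        case False
        moreover have "0 \<le> real (Suc (length es)) * mqs (e # es) us"
          using nn(1)[of "e # es"] by (intro mult_nonneg_nonneg) auto
        ultimately show ?thesis using first by simp
      qed
    qed
    also have "\<dots> = real (Suc (length es)) * mqs (e # es) (u # us)"
      by (simp add: es algebra_simps)
    finally show ?thesis .
  qed
qed simp

section \<open>Dissolving a layer into the antilayer\<close>

text \<open>Of the \<open>2 ^ l\<close> products in the expansion of \<open>(x + y) ^ l\<close>,
  those containing \<open>x\<close> at most once are kept, and each of the other
  \<open>2 ^ l - l - 1\<close> is at least \<open>t ^ l\<close>. The bound on \<open>k\<close>
  originates here.\<close>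

lemma power_sum_lower_bound:
  fixes x y t :: real
  assumes "0 \<le> t" "t \<le> x" "t \<le> y" "1 \<le> l"
  shows "y ^ l + real l * x * y ^ (l - 1) + (2 ^ l - real l - 1) * t ^ l \<le> (x + y) ^ l"
  using assms(4)
proof (induction l rule: nat_induct_at_least)
  case (Suc l)
  define c where "c = 2 ^ l - real l - (1::real)"
  have "real l + 1 \<le> 2 ^ l"
    by (induction l) auto
  then have c: "0 \<le> c" by (simp add: c_def)
  obtain j where j: "l = Suc j" using Suc.hyps by (cases l) auto
  have "(x + y) * (y ^ l + real l * x * y ^ (l - 1) + c * t ^ l) \<le> (x + y) * (x + y) ^ l"
    using Suc.IH assms by (intro mult_left_mono) (auto simp: c_def)
  \<comment> \<open>Multiplying by \<open>x + y\<close> doubles the \<open>c\<close> old products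
    and creates \<open>l\<close> new ones from \<open>x * (l * x * y ^ (l - 1))\<close>;
    \<open>2 * c + l\<close> is the constant for \<open>Suc l\<close>.\<close>
  moreover have "t * t * t ^ j \<le> x * x * y ^ j"
    using assms by (intro mult_mono power_mono) auto
  then have "real l * (t * t * t ^ j) \<le> real l * (x * x * y ^ j)"
    by (intro mult_left_mono) auto
  moreover have "c * (t * t ^ l) \<le> c * (x * t ^ l)" "c * (t * t ^ l) \<le> c * (y * t ^ l)"
    using c assms by (intro mult_left_mono mult_right_mono; auto)+
  ultimately have "y ^ Suc l + real (Suc l) * x * y ^ l + (2 * c + real l) * (t * t ^ l)
      \<le> (x + y) ^ Suc l"
    by (simp add: j algebra_simps)
  moreover have "2 * c + real l = 2 ^ Suc l - real (Suc l) - 1"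
    by (simp add: c_def)
  ultimately show ?case by simp
qed simp

text \<open>
  The limit of \<open>mqs\<close> with exponents \<open>1\<^sup>a, ls\<close> when the layers \<open>ws\<close> are preceded by ever more and ever
  smaller layers of total weight \<open>A\<close>: choosing \<open>i\<close> of the latter contributes \<open>A\<^sup>i / i!\<close>.
\<close>

definition layered_sum :: "nat \<Rightarrow> nat list \<Rightarrow> real \<Rightarrow> real list \<Rightarrow> real" where
  "layered_sum a ls A ws = (\<Sum>i\<le>a. A ^ i / fact i * mqs (replicate (a - i) 1 @ ls) ws)"

lemma layered_sum_0 [simp]: "layered_sum 0 ls A ws = mqs ls ws"
  by (simp add: layered_sum_def)

lemma layered_sum_antilayer_0: "layered_sum a ls 0 ws = mqs (replicate a 1 @ ls) ws"
proof -
  have "layered_sum a ls 0 ws = (\<Sum>i\<in>{0}. (0::real) ^ i / fact i * mqs (replicate (a - i) 1 @ ls) ws)"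
    unfolding layered_sum_def by (rule sum.mono_neutral_right) auto
  then show ?thesis by simp
qed

text \<open>The first layer \<open>w\<close> is skipped, plays an exponent 1, or plays
  \<open>l\<close>. The last case forces all \<open>Suc a\<close> exponents 1 into the antilayer,
  since nothing else precedes \<open>w\<close>.\<close>

lemma layered_sum_Cons:
  "layered_sum (Suc a) (l # ls) A (w # ws) =
     layered_sum (Suc a) (l # ls) A ws + w * layered_sum a (l # ls) A ws
     + A ^ Suc a / fact (Suc a) * w ^ l * mqs ls ws"
proof -
  have *: "mqs (replicate (Suc a - i) 1 @ l # ls) (w # ws) =
      mqs (replicate (Suc a - i) 1 @ l # ls) ws + w * mqs (replicate (a - i) 1 @ l # ls) ws"
    if "i \<le> a" for i
    using that by (simp add: Suc_diff_le)
  have "layered_sum (Suc a) (l # ls) A (w # ws) =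
      (\<Sum>i\<le>a. A ^ i / fact i * mqs (replicate (Suc a - i) 1 @ l # ls) (w # ws))
      + A ^ Suc a / fact (Suc a) * mqs (l # ls) (w # ws)"
    by (simp add: layered_sum_def)
  also have "(\<Sum>i\<le>a. A ^ i / fact i * mqs (replicate (Suc a - i) 1 @ l # ls) (w # ws)) =
      (\<Sum>i\<le>a. A ^ i / fact i * mqs (replicate (Suc a - i) 1 @ l # ls) ws)
      + w * layered_sum a (l # ls) A ws"
    unfolding layered_sum_def sum_distrib_left sum.distrib[symmetric]
    by (intro sum.cong refl) (simp only: atMost_iff *, simp add: algebra_simps)
  finally show ?thesis by (simp add: layered_sum_def ring_distribs)
qed

text \<open>For fewer than \<open>a\<close> entries in the antilayer there is no loss to pay for, so
  the expansion without surplus (\<open>t = 0\<close>) suffices.\<close>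

lemma power_divide_fact_sum_lower:
  fixes A w :: real
  assumes "0 \<le> A" "0 \<le> w"
  shows "A ^ i / fact i + w * (if i = 0 then 0 else A ^ (i - 1) / fact (i - 1)) \<le> (A + w) ^ i / fact i"
proof (cases i)
  case (Suc j)
  have "A ^ i + real i * w * A ^ (i - 1) \<le> (w + A) ^ i"
    using power_sum_lower_bound[of 0 w A i] assms Suc by simp
  then have "(A ^ i + real i * w * A ^ (i - 1)) / fact i \<le> (A + w) ^ i / fact i"
    by (intro divide_right_mono) (auto simp: add.commute)
  moreover have "real i * w * A ^ (i - 1) / fact i = w * (A ^ j / fact j)"
    by (simp add: Suc del: of_nat_Suc)
  ultimately show ?thesis using Suc by (simp add: add_divide_distrib del: fact_Suc)
qed simp

text \<open>After expanding \<open>(A + w) ^ i\<close>, only the choices where \<open>w\<close>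
  carries \<open>l\<close> lack a counterpart on the right, and they occur for \<open>i = a\<close>
  alone. They are paid by the surplus \<open>(2 ^ a - a - 1) * t ^ a\<close> with
  \<open>t = min A w\<close>, because \<open>mqs_insert_layer\<close> replaces
  \<open>z ^ l * mqs ls ws\<close> by \<open>k\<close> times \<open>m a\<close>.\<close>

lemma layered_sum_convert:
  fixes A w z :: real
  assumes "sorted (l # ls)" "2 \<le> a" "a \<le> l" "real (length (l # ls)) \<le> 2 ^ a - real a - 1"
    and "0 \<le> A" "0 \<le> w" "sorted ws" "\<And>v. v \<in> set ws \<Longrightarrow> 0 \<le> v" "length ls < length ws"
    and "z = ws ! (length ws - Suc (length ls))" "A \<le> z" "w \<le> z"
  shows "layered_sum a (l # ls) A (w # ws) \<le> layered_sum a (l # ls) (A + w) ws"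
proof -
  define k where "k = real (length (l # ls))"
  define m where "m i = mqs (replicate (a - i) 1 @ l # ls) ws" for i
  have m: "0 \<le> m i" for i unfolding m_def using assms by (intro mqs_nonneg) auto
  define t where "t = min A w"
  have t0: "0 \<le> t" using assms by (simp add: t_def)
  obtain b where b: "a = Suc b" using assms by (cases a) auto
  have ins: "z ^ l * mqs ls ws \<le> k * m a"
    using mqs_insert_layer[of l ls ws z] assms by (simp add: k_def m_def del: mqs.simps)
  \<comment> \<open>Here \<open>A \<le> z\<close> enters: \<open>w * A = t * max A w\<close> with
    \<open>max A w \<le> z\<close> handles \<open>a\<close> of the factors \<open>w\<close>, and the
    remaining \<open>l - a\<close> are at most \<open>z\<close> each.\<close>
  have tz: "w ^ l * A ^ a \<le> z ^ l * t ^ a"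
  proof -
    have "w * A = t * max A w" by (simp add: t_def min_def max_def)
    then have "w ^ a * A ^ a = t ^ a * max A w ^ a" by (simp flip: power_mult_distrib)
    also have "\<dots> \<le> t ^ a * z ^ a"
      using assms by (intro mult_left_mono power_mono) (auto simp: t_def)
    finally have 1: "w ^ a * A ^ a \<le> t ^ a * z ^ a" .
    have 2: "w ^ (l - a) \<le> z ^ (l - a)"
      using \<open>0 \<le> w\<close> \<open>w \<le> z\<close> by (intro power_mono)
    have "w ^ (l - a) * (w ^ a * A ^ a) \<le> z ^ (l - a) * (t ^ a * z ^ a)"
      by (rule mult_mono[OF 2 1]) (use \<open>0 \<le> A\<close> \<open>0 \<le> w\<close> \<open>w \<le> z\<close> in auto)
    moreover have "w ^ l = w ^ (l - a) * w ^ a" "z ^ l = z ^ (l - a) * z ^ a"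
      using assms(3) by (simp_all flip: power_add)
    ultimately show ?thesis by (simp add: mult_ac)
  qed
  have loss: "A ^ a * w ^ l * mqs ls ws \<le> k * t ^ a * m a"
  proof -
    have "A ^ a * w ^ l * mqs ls ws \<le> z ^ l * t ^ a * mqs ls ws"
      using tz assms by (intro mult_right_mono mqs_nonneg) (auto simp: mult.commute)
    also have "\<dots> = t ^ a * (z ^ l * mqs ls ws)" by simp
    also have "\<dots> \<le> t ^ a * (k * m a)"
      using ins assms by (intro mult_left_mono) (auto simp: t_def)
    finally show ?thesis by (simp add: mult_ac)
  qed
  have "A ^ a + real a * w * A ^ (a - 1) + k * t ^ a \<le> (A + w) ^ a"
  proof -
    have "k * t ^ a \<le> (2 ^ a - real a - 1) * t ^ a"
      using assms by (intro mult_right_mono) (auto simp: k_def t_def)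
    moreover have "A ^ a + real a * w * A ^ (a - 1) + (2 ^ a - real a - 1) * t ^ a \<le> (w + A) ^ a"
      by (rule power_sum_lower_bound) (use assms in \<open>auto simp: t_def\<close>)
    ultimately show ?thesis by (simp add: add.commute)
  qed
  then have "(A ^ a + real a * w * A ^ (a - 1) + k * t ^ a) / fact a * m a \<le> (A + w) ^ a / fact a * m a"
    by (intro mult_right_mono divide_right_mono m) auto
  moreover have "real a * w * A ^ (a - 1) * m a / fact a = w * A ^ b * m a / fact b"
    by (simp add: b del: of_nat_Suc)
  moreover have "A ^ a / fact a * w ^ l * mqs ls ws \<le> k * t ^ a * m a / fact a"
    using divide_right_mono[OF loss, of "fact a"] by (simp add: mult_ac)
  ultimately have top: "A ^ a / fact a * m a + w * (A ^ b / fact b) * m a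
      + A ^ a / fact a * w ^ l * mqs ls ws \<le> (A + w) ^ a / fact a * m a"
    by (simp add: add_divide_distrib distrib_right)
  have "layered_sum a (l # ls) A (w # ws) =
      (\<Sum>i\<le>a. A ^ i / fact i * m i) + w * (\<Sum>i\<le>b. A ^ i / fact i * m (Suc i))
      + A ^ a / fact a * w ^ l * mqs ls ws"
    unfolding b layered_sum_Cons by (simp add: layered_sum_def m_def b)
  also have "w * (\<Sum>i\<le>b. A ^ i / fact i * m (Suc i)) =
      (\<Sum>i\<le>a. w * (if i = 0 then 0 else A ^ (i - 1) / fact (i - 1)) * m i)"
    unfolding b sum.atMost_Suc_shift by (simp add: sum_distrib_left mult_ac)
  also have "(\<Sum>i\<le>a. A ^ i / fact i * m i) + \<dots> + A ^ a / fact a * w ^ l * mqs ls ws =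
      (\<Sum>i\<le>b. (A ^ i / fact i + w * (if i = 0 then 0 else A ^ (i - 1) / fact (i - 1))) * m i)
      + (A ^ a / fact a * m a + w * (A ^ b / fact b) * m a
      + A ^ a / fact a * w ^ l * mqs ls ws)"
    unfolding b by (simp add: sum.distrib distrib_right)
  also have "\<dots> \<le> (\<Sum>i\<le>b. (A + w) ^ i / fact i * m i) + (A + w) ^ a / fact a * m a"
    using assms by (intro add_mono sum_mono mult_right_mono power_divide_fact_sum_lower m top)
  also have "\<dots> = layered_sum a (l # ls) (A + w) ws"
    by (simp add: layered_sum_def m_def b)
  finally show ?thesis .
qed


section \<open>Merging two adjacent layers\<close>

text \<open>Only the choices using both \<open>x\<close> and \<open>y\<close> are estimated:
  \<open>y\<close> lies below all of \<open>vs\<close>, so inserting it into the remaining choice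
  costs a factor \<open>length es\<close>.\<close>

lemma mqs_pair_le:
  fixes x y :: real
  assumes "sorted (e # es)" "0 \<le> x" "x \<le> y" "sorted vs" "\<And>v. v \<in> set vs \<Longrightarrow> y \<le> v"
    and "length es \<le> length vs"
  shows "mqs (e # es) (x # y # vs)
      \<le> mqs (e # es) vs + (x ^ e + y ^ e + real (length es) * x ^ e) * mqs es vs"
proof (cases es)
  case (Cons f es')
  have "0 \<le> v" if "v \<in> set vs" for v using assms(2,3) assms(5)[OF that] by simp
  moreover have "y \<le> vs ! (length vs - Suc (length es'))"
    using assms Cons by simp
  ultimately have "y ^ f * mqs es' vs \<le> real (Suc (length es')) * mqs (f # es') vs"
    using assms Cons by (intro mqs_insert_layer) auto
  then have "x ^ e * (y ^ f * mqs es' vs) \<le> x ^ e * (real (length es) * mqs es vs)"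
    using assms Cons by (intro mult_left_mono) auto
  then show ?thesis by (simp add: Cons algebra_simps)
qed (simp add: algebra_simps)

text \<open>The term with \<open>a\<close> on the left is slack, to be spent in
  \<open>layered_sum_merge\<close> on lost singletons; \<open>a = 0\<close> is plain merging. Of the
  \<open>e\<close> products \<open>x * y ^ (e - 1)\<close> in \<open>(x + y) ^ e\<close>,
  \<open>a\<close> are reserved for it and the others lowered to \<open>x ^ e\<close>. This yields
  \<open>2 ^ e - a - 1\<close> copies of \<open>x ^ e\<close>, enough for the
  \<open>length es + 1\<close> needed.\<close>

lemma mqs_merge_Nil:
  fixes x y :: real
  assumes "sorted (e # es)" "0 \<le> x" "x \<le> y" "sorted vs" "\<And>v. v \<in> set vs \<Longrightarrow> y \<le> v"
    and "length es \<le> length vs" "1 \<le> e" "a \<le> e" "real (length es) + a + 2 \<le> 2 ^ e"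
  shows "mqs (e # es) (x # y # vs) + real a * x * y ^ (e - 1) * mqs es vs
      \<le> mqs (e # es) ((x + y) # vs)"
proof -
  have nn: "0 \<le> mqs es vs"
    using assms by (intro mqs_nonneg) fastforce
  have "real (e - a) * (x * x ^ (e - 1)) \<le> real (e - a) * (x * y ^ (e - 1))"
    using assms by (intro mult_left_mono power_mono) auto
  moreover have "x ^ e = x * x ^ (e - 1)" using assms(7) by (simp flip: power_Suc)
  ultimately have 1: "(real e - real a) * x ^ e + real a * x * y ^ (e - 1) \<le> real e * x * y ^ (e - 1)"
    using assms by (simp add: of_nat_diff algebra_simps)
  have "(real (length es) + 1) * x ^ e \<le> (2 ^ e - real a - 1) * x ^ e"
    using assms by (intro mult_right_mono) auto
  moreover have "y ^ e + real e * x * y ^ (e - 1) + (2 ^ e - real e - 1) * x ^ e \<le> (x + y) ^ e"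
    using assms by (intro power_sum_lower_bound) auto
  ultimately have "x ^ e + y ^ e + real (length es) * x ^ e + real a * x * y ^ (e - 1) \<le> (x + y) ^ e"
    using 1 by (simp add: algebra_simps)
  then have "(x ^ e + y ^ e + real (length es) * x ^ e + real a * x * y ^ (e - 1)) * mqs es vs
      \<le> (x + y) ^ e * mqs es vs"
    using nn by (intro mult_right_mono)
  moreover have "mqs (e # es) (x # y # vs)
      \<le> mqs (e # es) vs + (x ^ e + y ^ e + real (length es) * x ^ e) * mqs es vs"
    by (rule mqs_pair_le) (use assms in auto)
  ultimately show ?thesis by (simp add: algebra_simps)
qed

text \<open>Each layer of \<open>us\<close> is skipped or uses up the first exponent, and the
  hypotheses pass to shorter exponent lists, so everything reduces to the case without
  \<open>us\<close> and without slack.\<close>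

lemma mqs_merge:
  fixes x y :: real
  assumes "sorted es" "0 \<le> x" "x \<le> y" "sorted vs" "\<And>v. v \<in> set vs \<Longrightarrow> y \<le> v"
    and "length es \<le> Suc (length vs)" "\<And>e. e \<in> set es \<Longrightarrow> 1 \<le> e \<and> real (length es) + 1 \<le> 2 ^ e"
    and "\<And>u. u \<in> set us \<Longrightarrow> 0 \<le> u"
  shows "mqs es (us @ x # y # vs) \<le> mqs es (us @ (x + y) # vs)"
  using assms(1,6,7,8)
proof (induction us arbitrary: es)
  case Nil
  show ?case
  proof (cases es)
    case (Cons e es')
    then have "1 \<le> e" "real (length es') + 2 \<le> 2 ^ e" "length es' \<le> length vs"
      using Nil(2) Nil(3)[of e] by auto
    then show ?thesis
      using mqs_merge_Nil[of e es' x y vs 0] Cons Nil(1) assms(2-5) by (simp del: mqs.simps)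
  qed simp
next
  case (Cons u us)
  show ?case
  proof (cases es)
    case es: (Cons e es')
    have "mqs es' (us @ x # y # vs) \<le> mqs es' (us @ (x + y) # vs)"
      using Cons.prems by (intro Cons.IH) (force simp: es)+
    moreover have "mqs es (us @ x # y # vs) \<le> mqs es (us @ (x + y) # vs)"
      using Cons.prems by (intro Cons.IH) auto
    ultimately show ?thesis
      using Cons.prems by (auto simp: es intro!: add_mono mult_left_mono)
  qed simp
qed

text \<open>With one layer more than \<open>ls\<close> requires, at most one exponent 1 fits into
  \<open>ws\<close>.\<close>

lemma layered_sum_length_Suc:
  assumes "length ws = Suc (length ls)"
  shows "layered_sum (Suc a) ls A ws = A ^ Suc a / fact (Suc a) * mqs ls ws + A ^ a / fact a * mqs (1 # ls) ws"
proof -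
  have "layered_sum (Suc a) ls A ws =
      (\<Sum>i\<in>{a, Suc a}. A ^ i / fact i * mqs (replicate (Suc a - i) 1 @ ls) ws)"
    unfolding layered_sum_def
    by (rule sum.mono_neutral_right) (auto simp: assms intro!: mqs_eq_0)
  then show ?thesis by simp
qed

lemma layered_sum_length_eq:
  assumes "length ws = length ls"
  shows "layered_sum a ls A ws = A ^ a / fact a * mqs ls ws"
proof -
  have "layered_sum a ls A ws =
      (\<Sum>i\<in>{a}. A ^ i / fact i * mqs (replicate (a - i) 1 @ ls) ws)"
    unfolding layered_sum_def
    by (rule sum.mono_neutral_right) (auto simp: assms intro!: mqs_eq_0)
  then show ?thesis by simp
qed

lemma layered_sum_eq_0:
  assumes "length ws < length ls"
  shows "layered_sum a ls A ws = 0"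
  unfolding layered_sum_def using assms by (intro sum.neutral ballI) (auto intro!: mqs_eq_0)

text \<open>With \<open>us\<close> empty, \<open>x # y # vs\<close> has one layer too many, and
  merging destroys the choices where \<open>x\<close> is a singleton and \<open>y\<close> carries
  \<open>l\<close>. As \<open>y \<le> A\<close>, one factor \<open>y\<close> can be replaced by
  \<open>A\<close>: with \<open>a = Suc b\<close>, \<open>A ^ b / fact b * x * y ^ l\<close> is at
  most \<open>A ^ a / fact a * (a * x * y ^ (l - 1))\<close>, exactly the slack of
  \<open>mqs_merge_Nil\<close>.\<close>

lemma layered_sum_merge:
  fixes A x y :: real
  assumes "sorted (l # ls)" "a \<le> l" "1 \<le> l" "real (length ls) + a + 2 \<le> 2 ^ l"
    and "0 \<le> x" "x \<le> y" "y \<le> A" "sorted vs" "\<And>v. v \<in> set vs \<Longrightarrow> y \<le> v"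
    and "length vs = length ls" "\<And>u. u \<in> set us \<Longrightarrow> 0 \<le> u"
  shows "layered_sum a (l # ls) A (us @ x # y # vs) \<le> layered_sum a (l # ls) A (us @ (x + y) # vs)"
  using assms(2,4,11)
proof (induction us arbitrary: a)
  case Nil
  have nn: "0 \<le> mqs ls vs"
    using assms by (intro mqs_nonneg) fastforce
  show ?case
  proof (cases a)
    case 0
    then show ?thesis
      using mqs_merge_Nil[of l ls x y vs 0] Nil assms by (simp del: mqs.simps)
  next
    case (Suc b)
    have "y * y ^ (l - 1) = y ^ l"
      using assms(3) by (simp flip: power_Suc)
    then have y: "y ^ l \<le> A * y ^ (l - 1)"
      using assms mult_right_mono[of y A "y ^ (l - 1)"] by simp
    have "A ^ b * (x * mqs ls vs) * y ^ l \<le> A ^ b * (x * mqs ls vs) * (A * y ^ (l - 1))"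
      using assms nn by (intro mult_left_mono y) auto
    then have "A ^ b / fact b * (x * y ^ l * mqs ls vs)
        \<le> A ^ b * (x * mqs ls vs) * (A * y ^ (l - 1)) / fact b"
      by (simp add: divide_right_mono mult_ac)
    also have "\<dots> = A ^ a / fact a * (real a * x * y ^ (l - 1) * mqs ls vs)"
      by (simp add: Suc del: of_nat_Suc)
    finally have 1: "A ^ b / fact b * mqs (1 # l # ls) (x # y # vs)
        \<le> A ^ a / fact a * (real a * x * y ^ (l - 1) * mqs ls vs)"
      using assms by (simp add: mqs_eq_0)
    have "A ^ a / fact a * (mqs (l # ls) (x # y # vs) + real a * x * y ^ (l - 1) * mqs ls vs)
        \<le> A ^ a / fact a * mqs (l # ls) ((x + y) # vs)"
      using mqs_merge_Nil[of l ls x y vs a] Nil assms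
      by (intro mult_left_mono) (auto simp del: mqs.simps)
    then have "A ^ a / fact a * mqs (l # ls) (x # y # vs) + A ^ b / fact b * mqs (1 # l # ls) (x # y # vs)
        \<le> A ^ a / fact a * mqs (l # ls) ((x + y) # vs)"
      using 1 by (simp add: ring_distribs del: mqs.simps fact_Suc)
    moreover have "layered_sum a (l # ls) A (x # y # vs) = A ^ a / fact a * mqs (l # ls) (x # y # vs)
        + A ^ b / fact b * mqs (1 # l # ls) (x # y # vs)"
      unfolding Suc using assms by (intro layered_sum_length_Suc) simp
    moreover have "layered_sum a (l # ls) A ((x + y) # vs) = A ^ a / fact a * mqs (l # ls) ((x + y) # vs)"
      using assms by (intro layered_sum_length_eq) simp
    ultimately show ?thesis by simp
  qed
next
  case (Cons u us)
  have exps: "1 \<le> e \<and> real (length (l # ls)) + 1 \<le> 2 ^ e" if "e \<in> set (l # ls)" for e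
  proof -
    have "l \<le> e" using assms(1) that by auto
    then have "(2::real) ^ l \<le> 2 ^ e" by (intro power_increasing) auto
    then show ?thesis using assms(3,4) \<open>l \<le> e\<close> by (auto simp del: power_increasing_iff)
  qed
  have exps_tail: "1 \<le> e \<and> real (length ls) + 1 \<le> 2 ^ e" if "e \<in> set ls" for e
    using exps[of e] that by auto
  have full: "mqs (l # ls) (us @ x # y # vs) \<le> mqs (l # ls) (us @ (x + y) # vs)"
    using assms(1,5,6,8-10) Cons.prems(3) exps by (intro mqs_merge) simp_all
  have tail: "mqs ls (us @ x # y # vs) \<le> mqs ls (us @ (x + y) # vs)"
    using assms(1,5,6,8-10) Cons.prems(3) exps_tail by (intro mqs_merge) simp_all
  show ?case
  proof (cases a)
    case 0
    then show ?thesis using full tail Cons.prems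
      by (auto intro!: add_mono mult_left_mono)
  next
    case (Suc b)
    have "layered_sum a (l # ls) A (us @ x # y # vs) \<le> layered_sum a (l # ls) A (us @ (x + y) # vs)"
      "layered_sum b (l # ls) A (us @ x # y # vs) \<le> layered_sum b (l # ls) A (us @ (x + y) # vs)"
      using Cons.prems Suc by (intro Cons.IH; auto)+
    then show ?thesis
      using tail Cons.prems assms unfolding Suc append_Cons layered_sum_Cons
      by (intro add_mono mult_left_mono) auto
  qed
qed

lemma layered_sum_sort_le:
  assumes "sorted ls" "\<And>l. l \<in> set ls \<Longrightarrow> 1 \<le> l" "0 \<le> A" "\<And>w. w \<in> set ws \<Longrightarrow> 0 \<le> w"
  shows "layered_sum a ls A ws \<le> layered_sum a ls A (sort ws)"
  unfolding layered_sum_def using assms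
  by (intro sum_mono mult_left_mono mqs_sort_le) (auto simp: sorted_append)

section \<open>Weighted AM-GM and the bound for all layer lists\<close>

text \<open>The maximum of \<open>A ^ a / fact a\<close> times the product of the
  \<open>w ^ l\<close> at total weight 1, attained at weights proportional to the exponents.\<close>

definition layered_const :: "nat \<Rightarrow> nat list \<Rightarrow> real" where
  "layered_const a ls = real a ^ a / fact a * (\<Prod>l\<leftarrow>ls. real l ^ l) / real (a + sum_list ls) ^ (a + sum_list ls)"

text \<open>The \<open>e\<close>-th power of \<open>t \<le> exp (t - 1)\<close> at
  \<open>t = x / (e * s)\<close>, with equality for \<open>x = e * s\<close>.\<close>

lemma power_le_exp:
  fixes x s :: real
  assumes "0 \<le> x" "0 < s" "0 < e"
  shows "x ^ e \<le> real e ^ e * s ^ e * exp (x / s - real e)"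
proof -
  have "x / (real e * s) \<le> exp (x / (real e * s) - 1)"
    using exp_ge_add_one_self[of "x / (real e * s) - 1"] by simp
  then have "(x / (real e * s)) ^ e \<le> exp (x / (real e * s) - 1) ^ e"
    using assms by (intro power_mono) auto
  also have "\<dots> = exp (x / s - real e)"
    using assms by (simp flip: exp_of_nat_mult add: field_simps)
  finally show ?thesis using assms by (simp add: field_simps power_mult_distrib)
qed

text \<open>If \<open>s\<close> is total weight divided by total exponent, the exponential factor is
  1 and this is weighted AM-GM.\<close>

lemma prod_power_le_exp:
  fixes s :: real
  assumes "length ws = length es" "\<And>w. w \<in> set ws \<Longrightarrow> 0 \<le> w" "0 < s" "\<And>e. e \<in> set es \<Longrightarrow> 0 < e"
  shows "mqs es ws \<le> (\<Prod>e\<leftarrow>es. real e ^ e) * s ^ sum_list es * exp (sum_list ws / s - sum_list es)"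
  using assms
proof (induction es ws rule: list_induct2')
  case (4 e es w ws)
  have IH: "mqs es ws \<le> (\<Prod>e\<leftarrow>es. real e ^ e) * s ^ sum_list es * exp (sum_list ws / s - sum_list es)"
    using 4 by simp
  have "mqs (e # es) (w # ws) = w ^ e * mqs es ws"
    using 4 by (simp add: mqs_eq_0)
  also have "\<dots> \<le> (real e ^ e * s ^ e * exp (w / s - real e)) *
      ((\<Prod>e\<leftarrow>es. real e ^ e) * s ^ sum_list es * exp (sum_list ws / s - sum_list es))"
    using 4 by (intro mult_mono power_le_exp IH mqs_nonneg) auto
  also have "\<dots> = (\<Prod>e\<leftarrow>e#es. real e ^ e) * s ^ sum_list (e#es) *
      (exp (w / s - real e) * exp (sum_list ws / s - sum_list es))"
    by (simp add: power_add mult_ac)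
  also have "exp (w / s - real e) * exp (sum_list ws / s - sum_list es) =
      exp (sum_list (w # ws) / s - sum_list (e # es))"
    by (simp flip: exp_add add: add_divide_distrib algebra_simps)
  finally show ?case .
qed auto

lemma layered_sum_base:
  assumes "length ws = length ls" "\<And>w. w \<in> set ws \<Longrightarrow> 0 \<le> w" "0 \<le> A" "0 < a"
    and "\<And>l. l \<in> set ls \<Longrightarrow> 0 < l"
  shows "layered_sum a ls A ws \<le> layered_const a ls * (A + sum_list ws) ^ (a + sum_list ls)"
proof -
  define n where "n = a + sum_list ls"
  define S where "S = A + sum_list ws"
  have n: "0 < n" using assms by (simp add: n_def)
  have S: "0 \<le> sum_list ws" using assms by (intro sum_list_nonneg)
  have nn: "0 \<le> (\<Prod>l\<leftarrow>ls. real l ^ l)" by (induction ls) auto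
  show ?thesis
  proof (cases "S = 0")
    case True
    then have "A = 0" "sum_list ws = 0" using S assms by (simp_all add: S_def)
    moreover have "0 \<le> layered_const a ls"
      unfolding layered_const_def using nn by simp
    ultimately show ?thesis using assms S by (simp add: layered_sum_length_eq zero_power)
  next
    case False
    define s where "s = S / n"
    have s: "0 < s" using False S assms n by (simp add: s_def S_def)
    \<comment> \<open>The antilayer mass counts as one more weight with exponent \<open>a\<close>;
      the lists have equal length, so the polynomial is a single monomial.\<close>
    have "mqs (a # ls) (A # ws) \<le> (\<Prod>e\<leftarrow>a # ls. real e ^ e) * s ^ sum_list (a # ls)
        * exp (sum_list (A # ws) / s - sum_list (a # ls))"
      using assms s by (intro prod_power_le_exp) auto
    also have "sum_list (A # ws) / s - sum_list (a # ls) = 0"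
      using False n by (simp add: s_def S_def[symmetric] n_def[symmetric] del: of_nat_add)
    finally have "A ^ a * mqs ls ws \<le> real a ^ a * (\<Prod>l\<leftarrow>ls. real l ^ l) * (S / n) ^ n"
      using assms by (simp add: mqs_eq_0 s_def n_def)
    then have "A ^ a * mqs ls ws / fact a \<le> real a ^ a * (\<Prod>l\<leftarrow>ls. real l ^ l) * (S / n) ^ n / fact a"
      by (intro divide_right_mono) auto
    then show ?thesis using assms
      by (simp add: layered_sum_length_eq layered_const_def power_divide mult_ac flip: n_def S_def)
  qed
qed

theorem layered_sum_le:
  assumes ls: "ls \<noteq> []" "sorted ls" "2 \<le> a" "\<And>l. l \<in> set ls \<Longrightarrow> a \<le> l"
    and len: "real (length ls) \<le> 2 ^ a - real a - 1"
    and "\<And>w. w \<in> set ws \<Longrightarrow> 0 \<le> w" "0 \<le> A"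
  shows "layered_sum a ls A ws \<le> layered_const a ls * (A + sum_list ws) ^ (a + sum_list ls)"
  using assms(6,7)
proof (induction "length ws" arbitrary: A ws rule: less_induct)
  case less
  define us where "us = sort ws"
  define m where "m = length us"
  define k where "k = length ls"
  obtain l ls' where l: "ls = l # ls'" using ls by (cases ls) auto
  have "sum_list (insort w zs) = w + sum_list zs" for w :: real and zs
    by (induction zs) auto
  then have "sum_list (sort zs) = sum_list zs" for zs :: "real list"
    by (induction zs) auto
  then have us: "sorted us" "\<And>u. u \<in> set us \<Longrightarrow> 0 \<le> u" "length us = length ws" "sum_list us = sum_list ws"
    using less.prems by (auto simp: us_def)
  have pos: "1 \<le> e" "0 < e" if "e \<in> set ls" for e
    using ls(3) ls(4)[OF that] by auto
  have sort: "layered_sum a ls A ws \<le> layered_sum a ls A us"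
    unfolding us_def using ls(2) pos(1) less.prems by (intro layered_sum_sort_le)
  have "layered_sum a ls A us \<le> layered_const a ls * (A + sum_list us) ^ (a + sum_list ls)"
  proof (cases k m rule: linorder_cases)
    case greater
    have "0 \<le> (\<Prod>l\<leftarrow>ls. real l ^ l)" by (induction ls) auto
    moreover have "0 \<le> sum_list us" using us by (intro sum_list_nonneg)
    ultimately show ?thesis
      using greater less.prems by (simp add: layered_sum_eq_0 m_def k_def layered_const_def)
  next
    case equal
    show ?thesis
      using equal ls(3) pos(2) us(2) less.prems(2)
      by (intro layered_sum_base) (simp_all add: m_def k_def)
  next
    case km: less
    have k: "0 < k" using l by (simp add: k_def)
    define y where "y = us ! (m - k)"
    show ?thesis
    proof (cases "A \<le> y")
      case True
      obtain w vs where w: "us = w # vs" using km by (cases us) (auto simp: m_def)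
      \<comment> \<open>There are more than \<open>k\<close> layers, so dropping the smallest does
        not change the \<open>k\<close>-th largest.\<close>
      have y: "y = vs ! (length vs - k)"
        using km by (simp add: y_def w m_def nth_Cons' k_def Suc_diff_le)
      then have "w \<le> y" using us(1) km k by (auto simp: w m_def)
      then have "layered_sum a ls A us \<le> layered_sum a ls (A + w) vs"
        unfolding l w using ls len us less.prems True y km
        by (intro layered_sum_convert[where z = y]) (auto simp: l w m_def k_def)
      also have "\<dots> \<le> layered_const a ls * (A + w + sum_list vs) ^ (a + sum_list ls)"
        using us less.prems by (intro less.hyps) (auto simp: w)
      finally show ?thesis by (simp add: w add.assoc)
    next
      case False
      define ps x vs where "ps = take (m - k - 1) us" and "x = us ! (m - k - 1)"
        and "vs = drop (m - k + 1) us"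
      have dec: "us = ps @ x # y # vs"
      proof -
        have "us = take (m - k - 1) us @ drop (m - k - 1) us" by simp
        also have "drop (m - k - 1) us = x # drop (m - k) us"
          using km k Cons_nth_drop_Suc[of "m - k - 1" us] by (simp add: x_def m_def Suc_diff_Suc)
        also have "drop (m - k) us = y # vs"
          using km k Cons_nth_drop_Suc[of "m - k" us] by (simp add: y_def vs_def m_def)
        finally show ?thesis by (simp add: ps_def)
      qed
      have lv: "length vs = length ls'" using km by (simp add: vs_def m_def k_def l)
      have al: "a \<le> l" "1 \<le> l" using ls(3) ls(4)[of l] l by auto
      \<comment> \<open>Merging needs this with \<open>2 ^ l\<close> on the right but still
        \<open>a\<close> on the left, which is why the slack is \<open>a\<close> and not
        \<open>l\<close>.\<close>
      have "real (length ls') + real a + 2 \<le> 2 ^ a" using len by (simp add: l)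
      also have "(2::real) ^ a \<le> 2 ^ l" using al by (intro power_increasing) auto
      finally have "layered_sum a ls A us \<le> layered_sum a ls A (ps @ (x + y) # vs)"
        unfolding dec l using us(1,2) ls(2) False lv al
        by (intro layered_sum_merge) (auto simp: l dec sorted_append)
      also have "\<dots> \<le> layered_const a ls * (A + sum_list (ps @ (x + y) # vs)) ^ (a + sum_list ls)"
        using us less.prems arg_cong[OF dec, of length] by (intro less.hyps) (auto simp: dec)
      finally show ?thesis by (simp add: dec add.assoc)
    qed
  qed
  then show ?case using sort us by simp
qed


section \<open>Moving weight off inversions\<close>

lemma sum_inj_le:
  fixes f :: "'b \<Rightarrow> real"
  assumes "finite T" "inj_on g S" "g ` S \<subseteq> T" "\<And>t. t \<in> T \<Longrightarrow> 0 \<le> f t"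
  shows "(\<Sum>s\<in>S. f (g s)) \<le> sum f T"
proof -
  have "(\<Sum>s\<in>S. f (g s)) = sum f (g ` S)"
    using assms(2) by (simp add: sum.reindex)
  also have "\<dots> \<le> sum f T"
    using assms by (intro sum_mono2) auto
  finally show ?thesis .
qed

text \<open>
  With \<open>lt p q\<close> saying that \<open>p, q\<close> is a non-inversion of \<open>\<pi>\<close> and \<open>blk\<close> the layer index in \<open>\<sigma>\<close>, these
  are the ways to map the entries of \<open>\<sigma>\<close> to positions of \<open>\<pi>\<close>, where entries of one layer may
  share a position and may come in any order.
\<close>

definition block_hom :: "('v \<Rightarrow> 'v \<Rightarrow> bool) \<Rightarrow> ('d \<Rightarrow> nat) \<Rightarrow> 'd set \<Rightarrow> ('d \<Rightarrow> 'v) \<Rightarrow> bool" where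
  "block_hom lt blk D f \<longleftrightarrow> (\<forall>p\<in>D. \<forall>q\<in>D.
     (blk p < blk q \<longrightarrow> lt (f p) (f q)) \<and> (blk p = blk q \<longrightarrow> \<not> lt (f p) (f q)))"

definition hom_sum :: "('v \<Rightarrow> 'v \<Rightarrow> bool) \<Rightarrow> ('d \<Rightarrow> nat) \<Rightarrow> 'd set \<Rightarrow> 'v set \<Rightarrow> ('v \<Rightarrow> real) \<Rightarrow> real" where
  "hom_sum lt blk D V w = (\<Sum>f\<in>{f \<in> D \<rightarrow>\<^sub>E V. block_hom lt blk D f}. \<Prod>p\<in>D. w (f p))"

lemma hom_sum_empty: "hom_sum lt blk {} V w = 1"
  by (simp add: hom_sum_def block_hom_def)

lemma finite_homs:
  "finite D \<Longrightarrow> finite V \<Longrightarrow> finite {f \<in> D \<rightarrow>\<^sub>E V. block_hom lt blk D f}"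
  by (simp add: finite_PiE)

text \<open>Forgets which of \<open>x\<close> and \<open>y\<close> an entry uses. Maps are compared
  fibre by fibre, because a single map need not satisfy the convexity inequality.\<close>

definition collapse :: "'v \<Rightarrow> 'v \<Rightarrow> 'd set \<Rightarrow> ('d \<Rightarrow> 'v) \<Rightarrow> 'd \<Rightarrow> 'v" where
  "collapse x y D f = (\<lambda>p\<in>D. if f p = y then x else f p)"

text \<open>For \<open>z = x\<close> and \<open>z = y\<close> these are the two endpoints of the
  exchange of weight between \<open>x\<close> and \<open>y\<close>.\<close>

definition concentrate :: "'v \<Rightarrow> 'v \<Rightarrow> 'v \<Rightarrow> ('v \<Rightarrow> real) \<Rightarrow> 'v \<Rightarrow> real" where
  "concentrate x y z w = (\<lambda>v. if v = z then w x + w y else if v = x \<or> v = y then 0 else w v)"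

text \<open>
  Entries sent to \<open>x\<close> or \<open>y\<close> all lie in one block, as \<open>x\<close> and \<open>y\<close> are incomparable. So once
  the entry \<open>p0\<close> may be sent to \<open>z\<close>, all of them may.
\<close>

lemma fibre_sum_le:
  fixes lt :: "'v \<Rightarrow> 'v \<Rightarrow> bool" and blk :: "'d \<Rightarrow> nat" and w :: "'v \<Rightarrow> real"
  assumes fin: "finite D" "finite V" and irr: "\<And>v. \<not> lt v v"
    and xy: "x \<in> V" "y \<in> V" "x \<noteq> y" "\<not> lt x y" "\<not> lt y x"
    and w: "\<And>v. v \<in> V \<Longrightarrow> 0 \<le> w v"
    and z: "z = x \<or> z = y" and p0: "p0 \<in> D" "h p0 = x"
  defines "F \<equiv> {f \<in> {f \<in> D \<rightarrow>\<^sub>E V. block_hom lt blk D f}. collapse x y D f = h}"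
  shows "(w x + w y) * (\<Sum>f\<in>{f \<in> F. f p0 = z}. \<Prod>p\<in>D. w (f p))
      \<le> w z * (\<Sum>f\<in>F. \<Prod>p\<in>D. concentrate x y z w (f p))"
proof -
  define T where "T = w x + w y"
  define G where "G = {f \<in> F. f p0 = z}"
  \<comment> \<open>All maps of the fibre send exactly the entries of \<open>U\<close> to
    \<open>x\<close> or \<open>y\<close> and agree elsewhere; \<open>R\<close> is the common weight
    of the other entries.\<close>
  define U where "U = {p \<in> D. h p = x}"
  define R where "R = (\<Prod>p\<in>D - U. w (h p))"
  have T: "0 \<le> T" "0 \<le> w z" "z \<in> V" using w xy z by (auto simp: T_def)
  have finF: "finite F" unfolding F_def by (rule finite_subset[OF _ finite_homs[OF fin, of lt blk]]) auto
  have conc: "0 \<le> concentrate x y z w v" if "v \<in> V" for v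
    using w[OF that] w[OF xy(1)] w[OF xy(2)] by (simp add: concentrate_def)
  have U: "U \<subseteq> D" "finite U" "p0 \<in> U" using fin p0 by (auto simp: U_def)
  have inU: "f p = x \<or> f p = y" if "f \<in> F" "p \<in> U" for f p
  proof -
    have "collapse x y D f p = x" "p \<in> D" using that by (auto simp: F_def U_def)
    then show ?thesis by (auto simp: collapse_def split: if_splits)
  qed
  have notU: "f p = h p" "f p \<noteq> x" "f p \<noteq> y" if "f \<in> F" "p \<in> D - U" for f p
    using that by (auto simp: F_def U_def collapse_def split: if_splits)
  show ?thesis
  proof (cases "G = {}")
    case True
    have "0 \<le> (\<Sum>f\<in>F. \<Prod>p\<in>D. concentrate x y z w (f p))"
      by (intro sum_nonneg prod_nonneg conc) (auto simp: F_def)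
    then show ?thesis using True T unfolding G_def[symmetric] by simp
  next
    case False
    then obtain f0 where f0: "f0 \<in> F" "f0 p0 = z" by (auto simp: G_def)
    have f0V: "f0 \<in> D \<rightarrow>\<^sub>E V" "block_hom lt blk D f0" "collapse x y D f0 = h"
      using f0 by (auto simp: F_def)
    have hom0: "lt (f0 p) (f0 q)" if "p \<in> D" "q \<in> D" "blk p < blk q" for p q
      using f0V(2) that by (auto simp: block_hom_def)
    have hom1: "\<not> lt (f0 p) (f0 q)" if "p \<in> D" "q \<in> D" "blk p = blk q" for p q
      using f0V(2) that by (auto simp: block_hom_def)
    have R0: "0 \<le> R" unfolding R_def
    proof (rule prod_nonneg)
      fix p assume p: "p \<in> D - U"
      then have "f0 p \<in> V" using f0V(1) by (auto simp: PiE_def)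
      then show "0 \<le> w (h p)" using notU[OF f0(1) p] w by simp
    qed
    \<comment> \<open>This one map, with all of \<open>U\<close> at \<open>z\<close>, has
      concentrated weight \<open>R * T ^ card U\<close>, which is all that the right-hand side has
      to supply.\<close>
    define hz where "hz = (\<lambda>p\<in>D. if p \<in> U then z else f0 p)"
    have noblk: "\<not> blk p < blk q" if "p \<in> U" "q \<in> U" for p q
    proof
      assume "blk p < blk q"
      then have "lt (f0 p) (f0 q)" using that U by (intro hom0) auto
      then show False using inU[OF f0(1) that(1)] inU[OF f0(1) that(2)] irr xy by auto
    qed
    have blkU: "blk p = blk p0" if "p \<in> U" for p
      using noblk[OF that U(3)] noblk[OF U(3) that] by simp
    have hz: "hz \<in> F"
    proof -
      \<comment> \<open>Every entry of \<open>U\<close> lies in the block of \<open>p0\<close> and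
        can imitate it, so \<open>hz\<close> inherits its comparisons from
        \<open>f0\<close>.\<close>
      define rep where "rep p = (if p \<in> U then p0 else p)" for p
      have rep: "rep p \<in> D" "blk (rep p) = blk p" "hz p = f0 (rep p)" if "p \<in> D" for p
        using that blkU[of p] p0 f0(2) by (auto simp: rep_def hz_def)
      have "block_hom lt blk D hz"
        unfolding block_hom_def
      proof (intro ballI)
        fix p q assume pq: "p \<in> D" "q \<in> D"
        show "(blk p < blk q \<longrightarrow> lt (hz p) (hz q)) \<and> (blk p = blk q \<longrightarrow> \<not> lt (hz p) (hz q))"
          using hom0[of "rep p" "rep q"] hom1[of "rep p" "rep q"] rep[OF pq(1)] rep[OF pq(2)] by simp
      qed
      moreover have "hz \<in> D \<rightarrow>\<^sub>E V"
        using f0V(1) T(3) by (auto simp: hz_def)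
      moreover have "collapse x y D hz = h"
      proof
        fix p show "collapse x y D hz p = h p"
        proof (cases "p \<in> D")
          case True
          then show ?thesis
            using z notU[OF f0(1), of p] by (cases "p \<in> U") (auto simp: collapse_def hz_def U_def)
        next
          case False
          then show ?thesis using fun_cong[OF f0V(3), of p] by (simp add: collapse_def)
        qed
      qed
      ultimately show ?thesis by (simp add: F_def)
    qed
    have "(\<Prod>p\<in>D. concentrate x y z w (hz p)) =
        (\<Prod>p\<in>D - U. concentrate x y z w (hz p)) * (\<Prod>p\<in>U. concentrate x y z w (hz p))"
      using U fin by (intro prod.subset_diff)
    also have "(\<Prod>p\<in>U. concentrate x y z w (hz p)) = (\<Prod>p\<in>U. T)"
      using U by (intro prod.cong) (auto simp: hz_def concentrate_def T_def)
    also have "(\<Prod>p\<in>D - U. concentrate x y z w (hz p)) = R"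
      unfolding R_def using notU[OF f0(1)] z
      by (intro prod.cong) (auto simp: hz_def concentrate_def)
    finally have "R * T ^ card U = (\<Prod>p\<in>D. concentrate x y z w (hz p))" by simp
    also have "\<dots> \<le> (\<Sum>f\<in>F. \<Prod>p\<in>D. concentrate x y z w (f p))"
      using hz finF by (intro member_le_sum prod_nonneg conc) (auto simp: F_def)
    finally have right: "R * T ^ card U \<le> (\<Sum>f\<in>F. \<Prod>p\<in>D. concentrate x y z w (f p))" .
    have weight: "(\<Prod>p\<in>D. w (f p)) = w z * R * (\<Prod>p\<in>U - {p0}. w (restrict f (U - {p0}) p))"
      if "f \<in> G" for f
    proof -
      have "(\<Prod>p\<in>D. w (f p)) = (\<Prod>p\<in>D - U. w (f p)) * (\<Prod>p\<in>U. w (f p))"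
        using U fin by (intro prod.subset_diff)
      also have "(\<Prod>p\<in>D - U. w (f p)) = R"
        unfolding R_def using notU(1)[of f] that by (intro prod.cong) (auto simp: G_def)
      also have "(\<Prod>p\<in>U. w (f p)) = w (f p0) * (\<Prod>p\<in>U - {p0}. w (f p))"
        using U by (intro prod.remove) auto
      finally show ?thesis using that by (simp add: G_def)
    qed
    have inj: "inj_on (\<lambda>f. restrict f (U - {p0})) G"
    proof (rule inj_onI)
      fix f g assume fg: "f \<in> G" "g \<in> G" "restrict f (U - {p0}) = restrict g (U - {p0})"
      show "f = g"
      proof
        fix p
        consider "p = p0" | "p \<in> U - {p0}" | "p \<in> D - U" | "p \<notin> D" by auto
        then show "f p = g p"
        proof cases
          case 2
          then show ?thesis using fun_cong[OF fg(3), of p] by simp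
        next
          case 3
          then show ?thesis using notU(1)[of f p] notU(1)[of g p] fg by (simp add: G_def)
        next
          case 4
          then show ?thesis using fg by (auto simp: G_def F_def PiE_def extensional_def)
        qed (use fg in \<open>simp add: G_def\<close>)
      qed
    qed
    have "(\<Sum>f\<in>G. \<Prod>p\<in>D. w (f p)) =
        w z * R * (\<Sum>f\<in>G. \<Prod>p\<in>U - {p0}. w (restrict f (U - {p0}) p))"
      unfolding sum_distrib_left by (intro sum.cong refl weight)
    \<comment> \<open>With \<open>p0\<close> fixed at \<open>z\<close>, at most all choices of
      \<open>x\<close> or \<open>y\<close> for the rest of \<open>U\<close> remain, giving
      \<open>T ^ (card U - 1)\<close>; the missing factor \<open>T\<close> is the one multiplying
      the left side of the claim.\<close>
    also have "\<dots> \<le> w z * R * (\<Sum>c\<in>(U - {p0}) \<rightarrow>\<^sub>E {x, y}. \<Prod>p\<in>U - {p0}. w (c p))"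
    proof (intro mult_left_mono sum_inj_le inj)
      show "(\<lambda>f. restrict f (U - {p0})) ` G \<subseteq> (U - {p0}) \<rightarrow>\<^sub>E {x, y}"
        unfolding image_subset_iff restrict_PiE_iff using inU by (auto simp: G_def)
      show "0 \<le> (\<Prod>p\<in>U - {p0}. w (c p))" if "c \<in> (U - {p0}) \<rightarrow>\<^sub>E {x, y}" for c
      proof (rule prod_nonneg)
        fix p assume "p \<in> U - {p0}"
        then have "c p \<in> {x, y}" using that by (rule PiE_mem[rotated])
        then show "0 \<le> w (c p)" using w xy by auto
      qed
    qed (use U T R0 in \<open>auto simp: finite_PiE\<close>)
    also have "(\<Sum>c\<in>(U - {p0}) \<rightarrow>\<^sub>E {x, y}. \<Prod>p\<in>U - {p0}. w (c p)) = T ^ card (U - {p0})"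
      using U xy by (subst prod_sum_PiE[symmetric]) (auto simp: T_def)
    finally have "T * (\<Sum>f\<in>G. \<Prod>p\<in>D. w (f p)) \<le> T * (w z * R * T ^ card (U - {p0}))"
      using T by (intro mult_left_mono)
    also have "\<dots> = w z * (R * T ^ card U)"
      using card.remove[OF U(2,3)] by simp
    also have "\<dots> \<le> w z * (\<Sum>f\<in>F. \<Prod>p\<in>D. concentrate x y z w (f p))"
      using T right by (intro mult_left_mono)
    finally show ?thesis by (simp add: T_def G_def)
  qed
qed

text \<open>This is convexity: if \<open>w x + w y\<close> is positive, \<open>w\<close> is the
  average of the two concentrated weightings with coefficients proportional to \<open>w x\<close>
  and \<open>w y\<close>. Fibres avoiding \<open>x\<close> and \<open>y\<close> do not change; any
  other is split by the image of one fixed entry \<open>p0\<close>.\<close>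

lemma hom_sum_concentrate:
  fixes lt :: "'v \<Rightarrow> 'v \<Rightarrow> bool" and blk :: "'d \<Rightarrow> nat" and w :: "'v \<Rightarrow> real"
  assumes fin: "finite D" "finite V" and irr: "\<And>v. \<not> lt v v"
    and xy: "x \<in> V" "y \<in> V" "x \<noteq> y" "\<not> lt x y" "\<not> lt y x"
    and w: "\<And>v. v \<in> V \<Longrightarrow> 0 \<le> w v"
  shows "(w x + w y) * hom_sum lt blk D V w
      \<le> w x * hom_sum lt blk D V (concentrate x y x w) + w y * hom_sum lt blk D V (concentrate x y y w)"
proof -
  define H where "H = {f \<in> D \<rightarrow>\<^sub>E V. block_hom lt blk D f}"
  have H: "finite H" unfolding H_def using finite_homs[OF fin] .
  have gen: "hom_sum lt blk D V u = (\<Sum>h\<in>collapse x y D ` H. \<Sum>f\<in>{f \<in> H. collapse x y D f = h}. \<Prod>p\<in>D. u (f p))" for u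
    unfolding hom_sum_def H_def[symmetric] by (rule sum.image_gen[OF H])
  have fibre: "(w x + w y) * (\<Sum>f\<in>{f \<in> H. collapse x y D f = h}. \<Prod>p\<in>D. w (f p))
      \<le> w x * (\<Sum>f\<in>{f \<in> H. collapse x y D f = h}. \<Prod>p\<in>D. concentrate x y x w (f p))
       + w y * (\<Sum>f\<in>{f \<in> H. collapse x y D f = h}. \<Prod>p\<in>D. concentrate x y y w (f p))"
    (is "_ * (\<Sum>f\<in>?F. _) \<le> _") for h
  proof (cases "\<exists>p0\<in>D. h p0 = x")
    case True
    then obtain p0 where p0: "p0 \<in> D" "h p0 = x" by blast
    have "f p0 = x \<or> f p0 = y" if "f \<in> ?F" for f
    proof -
      have "collapse x y D f p0 = x" using that p0 by auto
      then show ?thesis using p0(1) by (auto simp: collapse_def split: if_splits)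
    qed
    then have "?F = {f \<in> ?F. f p0 = x} \<union> {f \<in> ?F. f p0 = y}" by blast
    then have "(\<Sum>f\<in>?F. \<Prod>p\<in>D. w (f p)) =
        (\<Sum>f\<in>{f \<in> ?F. f p0 = x} \<union> {f \<in> ?F. f p0 = y}. \<Prod>p\<in>D. w (f p))"
      by (rule arg_cong[where f = "sum (\<lambda>f. \<Prod>p\<in>D. w (f p))"])
    also have "\<dots> = (\<Sum>f\<in>{f \<in> ?F. f p0 = x}. \<Prod>p\<in>D. w (f p)) + (\<Sum>f\<in>{f \<in> ?F. f p0 = y}. \<Prod>p\<in>D. w (f p))"
      using H xy by (intro sum.union_disjoint) auto
    finally show ?thesis
      using fibre_sum_le[where w = w and z = x and h = h and blk = blk, OF assms _ p0]
        fibre_sum_le[where w = w and z = y and h = h and blk = blk, OF assms _ p0]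
      unfolding H_def by (simp add: distrib_left)
  next
    case False
    have "f p \<noteq> x \<and> f p \<noteq> y" if "f \<in> ?F" "p \<in> D" for f p
      using that False by (auto simp: collapse_def split: if_splits)
    then have "(\<Sum>f\<in>?F. \<Prod>p\<in>D. concentrate x y z w (f p)) = (\<Sum>f\<in>?F. \<Prod>p\<in>D. w (f p))"
      if "z = x \<or> z = y" for z
      using that by (intro sum.cong prod.cong refl) (auto simp: concentrate_def)
    then show ?thesis by (simp add: distrib_right)
  qed
  show ?thesis
    unfolding gen sum_distrib_left[where A = "collapse x y D ` H"] sum.distrib[symmetric]
    by (intro sum_mono fibre)
qed

section \<open>Reduction to chains of positions\<close>

text \<open>By convexity one of the two endpoints does not decrease the sum, and it has a smaller
  support, so the exchange can be repeated until no incomparable pair carries weight.\<close>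

lemma hom_sum_chain_support:
  fixes lt :: "'v \<Rightarrow> 'v \<Rightarrow> bool" and blk :: "'d \<Rightarrow> nat" and w :: "'v \<Rightarrow> real"
  assumes fin: "finite D" "finite V" and irr: "\<And>v. \<not> lt v v"
    and w: "\<And>v. v \<in> V \<Longrightarrow> 0 \<le> w v"
  obtains u where "\<And>v. v \<in> V \<Longrightarrow> 0 \<le> u v" "sum u V = sum w V" "hom_sum lt blk D V w \<le> hom_sum lt blk D V u"
    "\<And>x y. x \<in> V \<Longrightarrow> y \<in> V \<Longrightarrow> u x \<noteq> 0 \<Longrightarrow> u y \<noteq> 0 \<Longrightarrow> x \<noteq> y \<Longrightarrow> lt x y \<or> lt y x"
proof -
  have "\<exists>u. (\<forall>v\<in>V. 0 \<le> u v) \<and> sum u V = sum w V \<and> hom_sum lt blk D V w \<le> hom_sum lt blk D V u \<and>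
    (\<forall>x\<in>V. \<forall>y\<in>V. u x \<noteq> 0 \<longrightarrow> u y \<noteq> 0 \<longrightarrow> x \<noteq> y \<longrightarrow> lt x y \<or> lt y x)"
    using w
  proof (induction "card {v \<in> V. w v \<noteq> 0}" arbitrary: w rule: less_induct)
    case less
    show ?case
    proof (cases "\<forall>x\<in>V. \<forall>y\<in>V. w x \<noteq> 0 \<longrightarrow> w y \<noteq> 0 \<longrightarrow> x \<noteq> y \<longrightarrow> lt x y \<or> lt y x")
      case True
      then show ?thesis using less.prems by blast
    next
      case False
      then obtain x y where xy: "x \<in> V" "y \<in> V" "x \<noteq> y" "\<not> lt x y" "\<not> lt y x" "w x \<noteq> 0" "w y \<noteq> 0"
        by blast
      have pos: "0 < w x" "0 < w y" using xy less.prems[of x] less.prems[of y] by simp_all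
      have conv: "(w x + w y) * hom_sum lt blk D V w
        \<le> w x * hom_sum lt blk D V (concentrate x y x w) + w y * hom_sum lt blk D V (concentrate x y y w)"
        using xy less.prems by (intro hom_sum_concentrate fin irr) auto
      obtain z where z: "z = x \<or> z = y" "hom_sum lt blk D V w \<le> hom_sum lt blk D V (concentrate x y z w)"
      proof (rule ccontr)
        assume "\<not> thesis"
        then have "hom_sum lt blk D V (concentrate x y x w) < hom_sum lt blk D V w"
          "hom_sum lt blk D V (concentrate x y y w) < hom_sum lt blk D V w"
          using that by force+
        then have "w x * hom_sum lt blk D V (concentrate x y x w) < w x * hom_sum lt blk D V w"
          "w y * hom_sum lt blk D V (concentrate x y y w) < w y * hom_sum lt blk D V w"
          using pos by simp_all
        then show False using conv by (simp add: distrib_right)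
      qed
      define u where "u = concentrate x y z w"
      have u0: "0 \<le> u v" if "v \<in> V" for v
        using that less.prems pos by (auto simp: u_def concentrate_def)
      have "{v \<in> V. u v \<noteq> 0} \<subset> {v \<in> V. w v \<noteq> 0}"
        using xy z(1) by (auto simp: u_def concentrate_def split: if_splits)
      then have "card {v \<in> V. u v \<noteq> 0} < card {v \<in> V. w v \<noteq> 0}"
        using fin by (intro psubset_card_mono) auto
      from less.hyps[OF this u0] obtain u' where
        u': "\<forall>v\<in>V. 0 \<le> u' v" "sum u' V = sum u V" "hom_sum lt blk D V u \<le> hom_sum lt blk D V u'"
        "\<forall>x\<in>V. \<forall>y\<in>V. u' x \<noteq> 0 \<longrightarrow> u' y \<noteq> 0 \<longrightarrow> x \<noteq> y \<longrightarrow> lt x y \<or> lt y x"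
        by blast
      have split: "sum g V = g x + g y + sum g (V - {x, y})" for g :: "'v \<Rightarrow> real"
      proof -
        have "sum g V = g x + sum g (V - {x})"
          using fin xy by (intro sum.remove) auto
        also have "sum g (V - {x}) = g y + sum g (V - {x} - {y})"
          using fin xy by (intro sum.remove) auto
        also have "V - {x} - {y} = V - {x, y}" by auto
        finally show ?thesis by simp
      qed
      have "sum u (V - {x, y}) = sum w (V - {x, y})"
        using z(1) by (intro sum.cong) (auto simp: u_def concentrate_def)
      moreover have "u x + u y = w x + w y"
        using z(1) xy(3) by (auto simp: u_def concentrate_def)
      ultimately have "sum u V = sum w V" unfolding split by simp
      then show ?thesis using u' z(2) unfolding u_def by (intro exI[of _ u']) auto
    qed
  qed
  then show thesis using that by blast
qed

lemma hom_sum_support: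
  assumes "finite D" "finite V"
  shows "hom_sum lt blk D V w = hom_sum lt blk D {v \<in> V. w v \<noteq> 0} w"
  unfolding hom_sum_def
proof (rule sum.mono_neutral_right)
  show "\<forall>f\<in>{f \<in> D \<rightarrow>\<^sub>E V. block_hom lt blk D f} - {f \<in> D \<rightarrow>\<^sub>E {v \<in> V. w v \<noteq> 0}. block_hom lt blk D f}.
      (\<Prod>p\<in>D. w (f p)) = 0"
  proof
    fix f assume f: "f \<in> {f \<in> D \<rightarrow>\<^sub>E V. block_hom lt blk D f} - {f \<in> D \<rightarrow>\<^sub>E {v \<in> V. w v \<noteq> 0}. block_hom lt blk D f}"
    then obtain p where "p \<in> D" "w (f p) = 0" by (auto simp: PiE_def Pi_def)
    then show "(\<Prod>p\<in>D. w (f p)) = 0" using assms(1) by (intro prod_zero) auto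
  qed
qed (use finite_homs[OF assms] in \<open>auto simp: PiE_def Pi_def\<close>)

text \<open>Distinct positions of a chain are comparable, so a block, whose images are pairwise
  incomparable, goes to a single position. The recursion is that of \<open>mqs\<close>: the first
  position \<open>v\<close> is skipped or receives the whole block \<open>s\<close>.\<close>

lemma hom_sum_chain_le:
  fixes w :: "'v \<Rightarrow> real"
  assumes D: "finite D" and irr: "\<And>v. \<not> lt v v" and asym: "\<And>u v. lt u v \<Longrightarrow> \<not> lt v u"
    and blk: "\<And>t. s \<le> t \<Longrightarrow> t < r \<Longrightarrow> \<exists>p\<in>D. blk p = t" "\<And>p. p \<in> D \<Longrightarrow> blk p < r"
    and vs: "sorted_wrt lt vs" "\<And>v. v \<in> set vs \<Longrightarrow> 0 \<le> w v"
  shows "hom_sum lt blk {p \<in> D. s \<le> blk p} (set vs) w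
    \<le> mqs (map (\<lambda>t. card {p \<in> D. blk p = t}) [s..<r]) (map w vs)"
  using blk(1) vs
proof (induction vs arbitrary: s)
  case Nil
  show ?case
  proof (cases "s < r")
    case True
    then obtain p where "p \<in> {p \<in> D. s \<le> blk p}" using Nil.prems(1)[of s] by auto
    then have "{p \<in> D. s \<le> blk p} \<rightarrow>\<^sub>E set [] = ({} :: ('a \<Rightarrow> 'v) set)" by (auto simp: PiE_eq_empty_iff)
    then show ?thesis using True by (simp add: hom_sum_def upt_conv_Cons)
  next
    case False
    then have empty: "{p \<in> D. s \<le> blk p} = {}" using blk(2) by force
    show ?thesis unfolding empty using False by (simp add: hom_sum_empty)
  qed
next
  case (Cons v vs)
  show ?case
  proof (cases "s < r")
    case False
    then have empty: "{p \<in> D. s \<le> blk p} = {}" using blk(2) by force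
    show ?thesis unfolding empty using False by (simp add: hom_sum_empty)
  next
    case True
    define e where "e t = card {p \<in> D. blk p = t}" for t
    define D0 where "D0 = {p \<in> D. s \<le> blk p}"
    define D1 where "D1 = {p \<in> D. Suc s \<le> blk p}"
    define B where "B = {p \<in> D. blk p = s}"
    have DB: "D0 = D1 \<union> B" "D1 \<inter> B = {}" "finite D1" "finite B" "finite D0"
      using D by (auto simp: D0_def D1_def B_def)
    define H1 where "H1 = {f \<in> D0 \<rightarrow>\<^sub>E set vs. block_hom lt blk D0 f}"
    define H2 where "H2 = {f \<in> D0 \<rightarrow>\<^sub>E set (v # vs). block_hom lt blk D0 f \<and> v \<in> f ` D0}"
    define H' where "H' = {f \<in> D1 \<rightarrow>\<^sub>E set vs. block_hom lt blk D1 f}"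
    have fin: "finite H1" "finite H2" "finite H'"
      unfolding H1_def H2_def H'_def using DB by (auto simp: finite_PiE)
    have wv: "0 \<le> w v" "\<And>u. u \<in> set vs \<Longrightarrow> 0 \<le> w u" using Cons.prems by auto
    \<comment> \<open>An entry of block \<open>s\<close> is sent to \<open>v\<close> whenever
      \<open>v\<close> is used, which keeps all later blocks away from \<open>v\<close>.\<close>
    obtain b where b: "b \<in> B" using Cons.prems(1)[of s] True by (auto simp: B_def)
    have H2: "f p = v" if f: "f \<in> H2" and p: "p \<in> B" for f p
    proof -
      have hom: "\<And>p q. p \<in> D0 \<Longrightarrow> q \<in> D0 \<Longrightarrow> (blk p < blk q \<longrightarrow> lt (f p) (f q)) \<and>
          (blk p = blk q \<longrightarrow> \<not> lt (f p) (f q))"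
        using f by (auto simp: H2_def block_hom_def)
      have mem: "\<And>p. p \<in> D0 \<Longrightarrow> f p \<in> set (v # vs)"
        using f by (auto simp: H2_def PiE_def Pi_def)
      obtain q where q: "q \<in> D0" "f q = v" using f by (auto simp: H2_def)
      have above: "lt v u" if "u \<in> set vs" for u using Cons.prems that by auto
      have "blk q = s"
      proof (rule ccontr)
        assume "blk q \<noteq> s"
        then have "lt (f p) v" using hom[of p q] q p by (auto simp: D0_def B_def)
        moreover have "f p \<in> set (v # vs)" using p DB by (intro mem) auto
        ultimately show False using irr asym above by auto
      qed
      then have "\<not> lt v (f p)" using hom[of q p] q p DB by (auto simp: B_def)
      moreover have "f p \<in> set (v # vs)" using p DB by (intro mem) auto
      ultimately show ?thesis using above by auto
    qed
    have H2': "f p \<in> set vs" if f: "f \<in> H2" and p: "p \<in> D1" for f p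
    proof -
      have "lt (f b) (f p)" using f p b DB by (auto simp: H2_def block_hom_def D1_def B_def)
      then have "f p \<noteq> v" using H2[OF f b] irr by auto
      moreover have "f p \<in> set (v # vs)" using f p DB by (auto simp: H2_def PiE_def Pi_def)
      ultimately show ?thesis by auto
    qed
    have "hom_sum lt blk D0 (set (v # vs)) w \<le> (\<Sum>f\<in>H1 \<union> H2. \<Prod>p\<in>D0. w (f p))"
      unfolding hom_sum_def
    proof (rule sum_mono2)
      show "{f \<in> D0 \<rightarrow>\<^sub>E set (v # vs). block_hom lt blk D0 f} \<subseteq> H1 \<union> H2"
        unfolding H1_def H2_def PiE_def Pi_def by auto
    next
      fix f assume "f \<in> H1 \<union> H2 - {f \<in> D0 \<rightarrow>\<^sub>E set (v # vs). block_hom lt blk D0 f}"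
      then have "f p \<in> set (v # vs)" if "p \<in> D0" for p
        using that by (auto simp: H1_def H2_def PiE_def Pi_def)
      then show "0 \<le> (\<Prod>p\<in>D0. w (f p))" using wv by (intro prod_nonneg) auto
    qed (use fin in auto)
    also have "\<dots> \<le> (\<Sum>f\<in>H1. \<Prod>p\<in>D0. w (f p)) + (\<Sum>f\<in>H2. \<Prod>p\<in>D0. w (f p))"
    proof -
      have "0 \<le> (\<Sum>f\<in>H1 \<inter> H2. \<Prod>p\<in>D0. w (f p))"
        using wv by (intro sum_nonneg prod_nonneg) (auto simp: H1_def PiE_def Pi_def)
      then show ?thesis using sum.union_inter[OF fin(1,2), of "\<lambda>f. \<Prod>p\<in>D0. w (f p)"] by simp
    qed
    also have "(\<Sum>f\<in>H2. \<Prod>p\<in>D0. w (f p)) = (\<Sum>f\<in>H2. w v ^ e s * (\<Prod>p\<in>D1. w (restrict f D1 p)))"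
    proof (rule sum.cong[OF refl])
      fix f assume f: "f \<in> H2"
      have "(\<Prod>p\<in>D0. w (f p)) = (\<Prod>p\<in>D1. w (f p)) * (\<Prod>p\<in>B. w (f p))"
        using DB by (simp add: prod.union_disjoint)
      also have "(\<Prod>p\<in>B. w (f p)) = w v ^ e s"
        using H2[OF f] by (simp add: e_def B_def)
      finally show "(\<Prod>p\<in>D0. w (f p)) = w v ^ e s * (\<Prod>p\<in>D1. w (restrict f D1 p))" by simp
    qed
    also have "\<dots> = w v ^ e s * (\<Sum>f\<in>H2. \<Prod>p\<in>D1. w (restrict f D1 p))"
      by (simp add: sum_distrib_left)
    also have "\<dots> \<le> w v ^ e s * (\<Sum>f\<in>H'. \<Prod>p\<in>D1. w (f p))"
    proof (intro mult_left_mono sum_inj_le)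
      show "inj_on (\<lambda>f. restrict f D1) H2"
      proof (rule inj_onI)
        fix f g assume fg: "f \<in> H2" "g \<in> H2" "restrict f D1 = restrict g D1"
        show "f = g"
        proof
          fix p
          consider "p \<in> D1" | "p \<in> B" | "p \<notin> D0" using DB by auto
          then show "f p = g p"
          proof cases
            case 1
            then show ?thesis using fun_cong[OF fg(3), of p] by simp
          next
            case 2
            then show ?thesis using H2[of f p] H2[of g p] fg by simp
          next
            case 3
            then show ?thesis using fg by (auto simp: H2_def PiE_def extensional_def)
          qed
        qed
      qed
      show "(\<lambda>f. restrict f D1) ` H2 \<subseteq> H'"
        using H2' DB by (auto simp: H'_def H2_def block_hom_def)
      show "0 \<le> (\<Prod>p\<in>D1. w (f p))" if "f \<in> H'" for f
        using that wv by (intro prod_nonneg) (auto simp: H'_def PiE_def Pi_def)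
    qed (use fin wv in auto)
    also have "(\<Sum>f\<in>H1. \<Prod>p\<in>D0. w (f p)) + \<dots> \<le> mqs (map e [s..<r]) (map w vs)
        + w v ^ e s * mqs (map e [Suc s..<r]) (map w vs)"
    proof (intro add_mono mult_left_mono)
      show "(\<Sum>f\<in>H1. \<Prod>p\<in>D0. w (f p)) \<le> mqs (map e [s..<r]) (map w vs)"
        using Cons.IH[of s] Cons.prems by (simp add: hom_sum_def H1_def D0_def e_def[abs_def])
      show "(\<Sum>f\<in>H'. \<Prod>p\<in>D1. w (f p)) \<le> mqs (map e [Suc s..<r]) (map w vs)"
        using Cons.IH[of "Suc s"] Cons.prems by (simp add: hom_sum_def H'_def D1_def e_def[abs_def])
    qed (use wv in auto)
    also have "\<dots> = mqs (map e [s..<r]) (map w (v # vs))"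
      using True by (simp add: upt_conv_Cons)
    finally show ?thesis by (simp add: D0_def e_def[abs_def])
  qed
qed


section \<open>Copies of layered permutations\<close>

text \<open>Positions count from 0 here, hence \<open>p - 1\<close> for \<open>p\<close> in
  \<open>{1..n}\<close>. Past the end the index is \<open>length rs\<close>.\<close>

primrec layer_index :: "nat list \<Rightarrow> nat \<Rightarrow> nat" where
  "layer_index [] i = 0"
| "layer_index (r # rs) i = (if i < r then 0 else Suc (layer_index rs (i - r)))"

lemma layer_index_less: "i < sum_list rs \<Longrightarrow> layer_index rs i < length rs"
  by (induction rs arbitrary: i) auto

lemma layer_index_mono: "i \<le> j \<Longrightarrow> layer_index rs i \<le> layer_index rs j"
  by (induction rs arbitrary: i j) auto

lemma layer_index_replicate:
  "layer_index (replicate a 1 @ rs) i = (if i < a then i else a + layer_index rs (i - a))"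
proof (induction a arbitrary: i)
  case (Suc a)
  then show ?case by (cases i) auto
qed simp

lemma card_layer_index:
  "t < length rs \<Longrightarrow> card {i. i < sum_list rs \<and> layer_index rs i = t} = rs ! t"
proof (induction rs arbitrary: t)
  case (Cons r rs)
  show ?case
  proof (cases t)
    case 0
    have "{i. i < sum_list (r # rs) \<and> layer_index (r # rs) i = 0} = {..<r}" by auto
    then show ?thesis using 0 by simp
  next
    case (Suc u)
    have "{i. i < sum_list (r # rs) \<and> layer_index (r # rs) i = t} =
        (\<lambda>i. r + i) ` {i. i < sum_list rs \<and> layer_index rs i = u}" (is "?L = ?R")
    proof
      show "?L \<subseteq> ?R"
      proof
        fix i assume "i \<in> ?L"
        then have "i = r + (i - r)" "i - r \<in> {i. i < sum_list rs \<and> layer_index rs i = u}"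
          using Suc by (auto split: if_splits)
        then show "i \<in> ?R" by blast
      qed
    qed (use Suc in auto)
    then have "card ?L = card {i. i < sum_list rs \<and> layer_index rs i = u}"
      by (simp add: card_image)
    then show ?thesis using Cons Suc by simp
  qed
qed simp

lemma card_layer_index_Suc:
  assumes "t < length rs"
  shows "card {p \<in> {1..sum_list rs}. layer_index rs (p - 1) = t} = rs ! t"
proof -
  have "{p \<in> {1..sum_list rs}. layer_index rs (p - 1) = t} =
      Suc ` {i. i < sum_list rs \<and> layer_index rs i = t}" (is "?L = ?R")
  proof
    show "?L \<subseteq> ?R"
    proof
      fix p assume "p \<in> ?L"
      then have "p = Suc (p - 1)" "p - 1 \<in> {i. i < sum_list rs \<and> layer_index rs i = t}" by auto
      then show "p \<in> ?R" by blast
    qed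
  qed auto
  then show ?thesis using card_layer_index[OF assms] by (simp add: card_image)
qed

lemma layer_word_less_iff:
  assumes "i < j" "j < sum_list rs"
  shows "layer_word s rs ! i < layer_word s rs ! j \<longleftrightarrow> layer_index rs i \<noteq> layer_index rs j"
  using assms
proof (induction rs arbitrary: i j s)
  case (Cons r rs)
  have first: "layer_word s (r # rs) ! m = s + r - m" if "m < r" for m
    using that by (simp add: nth_append rev_nth del: upt_Suc)
  have later: "layer_word s (r # rs) ! m = layer_word (s + r) rs ! (m - r)" if "r \<le> m" for m
    using that by (simp add: nth_append del: upt_Suc)
  consider "j < r" | "i < r" "r \<le> j" | "r \<le> i" by linarith
  then show ?case
  proof cases
    case 1
    then show ?thesis using Cons.prems first[of i] first[of j] by (simp del: layer_word.simps)
  next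
    case 2
    have "layer_word (s + r) rs ! (j - r) \<in> {s + r + 1..s + r + sum_list rs}"
      using layer_word_props[of "s + r" rs] nth_mem[of "j - r" "layer_word (s + r) rs"] 2 Cons.prems
      by auto
    then have "s + r - i < layer_word (s + r) rs ! (j - r)" by auto
    then show ?thesis using 2 first[of i] later[of j] by (simp del: layer_word.simps)
  next
    case 3
    have "i - r < j - r" "j - r < sum_list rs" using 3 Cons.prems by auto
    from Cons.IH[OF this, of "s + r"] show ?thesis
      using 3 Cons.prems later[of i] later[of j] by (simp del: layer_word.simps)
  qed
qed simp

lemma layer_sequence_less_iff:
  assumes \<sigma>: "has_layer_sequence \<sigma> rs" and "1 \<le> p" "p < q" "q \<le> sum_list rs"
  shows "\<sigma> p < \<sigma> q \<longleftrightarrow> layer_index rs (p - 1) \<noteq> layer_index rs (q - 1)"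
proof -
  have "\<sigma> m = layer_word 0 rs ! (m - 1)" if "1 \<le> m" "m \<le> sum_list rs" for m
  proof -
    have "layer_word 0 rs ! (m - 1) = map \<sigma> [1..<sum_list rs + 1] ! (m - 1)"
      using \<sigma> by (simp add: has_layer_sequence_def)
    also have "\<dots> = \<sigma> m"
      using that by (simp del: upt_Suc)
    finally show ?thesis by simp
  qed
  then show ?thesis
    using layer_word_less_iff[of "p - 1" "q - 1" rs 0] assms(2-4) by simp
qed

lemma nth_elem_strict_mono:
  assumes "finite A" "1 \<le> j" "j < k" "k \<le> card A"
  shows "nth_elem A j < nth_elem A k"
proof -
  have "sorted_wrt (<) (sorted_list_of_set A)" by simp
  then show ?thesis
    unfolding nth_elem_def by (rule sorted_wrt_nth_less) (use assms in auto)
qed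

lemma pattern_less_iff:
  assumes "finite A" "inj_on \<sigma> A" "j \<in> {1..card A}" "k \<in> {1..card A}"
  shows "\<sigma> (nth_elem A j) < \<sigma> (nth_elem A k) \<longleftrightarrow> pattern \<sigma> A j < pattern \<sigma> A k"
  using theI'[OF pattern_ex1[OF assms(1,2)]] assms(3,4) unfolding pattern_def by blast

text \<open>Pairs \<open>j < k\<close> are enough: by injectivity the reversed comparison is the
  negation.\<close>

lemma pattern_eqI:
  assumes A: "finite A" "inj_on \<pi> A" and \<sigma>: "\<sigma> permutes {1..card A}"
    and less: "\<And>j k. 1 \<le> j \<Longrightarrow> j < k \<Longrightarrow> k \<le> card A \<Longrightarrow>
      \<pi> (nth_elem A j) < \<pi> (nth_elem A k) \<longleftrightarrow> \<sigma> j < \<sigma> k"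
  shows "pattern \<pi> A = \<sigma>"
  unfolding pattern_def
proof (rule the1_equality[OF pattern_ex1[OF A]], intro conjI ballI \<sigma>)
  fix j k assume jk: "j \<in> {1..card A}" "k \<in> {1..card A}"
  show "\<pi> (nth_elem A j) < \<pi> (nth_elem A k) \<longleftrightarrow> \<sigma> j < \<sigma> k"
  proof (cases j k rule: linorder_cases)
    case greater
    have "nth_elem A j \<in> A" "nth_elem A k \<in> A"
      using nth_elem_bij[OF A(1)] jk by (auto simp: bij_betw_def)
    moreover have "nth_elem A j \<noteq> nth_elem A k"
      using nth_elem_strict_mono[OF A(1), of k j] greater jk by auto
    ultimately have "\<pi> (nth_elem A j) \<noteq> \<pi> (nth_elem A k)"
      using A(2) by (auto dest: inj_onD)
    moreover have "\<sigma> j \<noteq> \<sigma> k"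
      using greater permutes_inj[OF \<sigma>] by (auto dest: injD)
    ultimately show ?thesis using less[of k j] greater jk by auto
  qed (use less jk in auto)
qed

section \<open>Upper bound on the number of copies\<close>

text \<open>A permutation of the earlier blocks and one of block \<open>r\<close> have disjoint
  supports, so their composite determines both.\<close>

lemma prod_fact_le_card_block_permutations:
  fixes blk :: "'d \<Rightarrow> nat"
  assumes "finite D"
  shows "(\<Prod>t<r. fact (card {p \<in> D. blk p = t})) \<le>
     card {\<tau>. \<tau> permutes {p \<in> D. blk p < r} \<and> (\<forall>p. blk (\<tau> p) = blk p)}"
proof (induction r)
  case 0
  have "id \<in> {\<tau>. \<tau> permutes {p \<in> D. blk p < 0} \<and> (\<forall>p. blk (\<tau> p) = blk p)}" by auto
  moreover have "finite {\<tau>. \<tau> permutes {p \<in> D. blk p < 0} \<and> (\<forall>p. blk (\<tau> p) = blk p)}"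
    by (rule finite_subset[OF _ finite_permutations[of "{p \<in> D. blk p < 0}"]]) (use assms in auto)
  ultimately show ?case by (simp add: Suc_le_eq card_gt_0_iff)
next
  case (Suc r)
  define P where "P r = {\<tau>. \<tau> permutes {p \<in> D. blk p < r} \<and> (\<forall>p. blk (\<tau> p) = blk p)}" for r
  define B where "B = {p \<in> D. blk p = r}"
  define Q where "Q = {\<rho>. \<rho> permutes B}"
  have fin: "finite (P r)" for r
    unfolding P_def
    by (rule finite_subset[OF _ finite_permutations[of "{p \<in> D. blk p < r}"]]) (use assms in auto)
  have "(\<Prod>t<Suc r. fact (card {p \<in> D. blk p = t})) \<le> card (P r) * fact (card B)"
    using Suc by (simp add: P_def B_def)
  also have "fact (card B) = card Q"
    unfolding Q_def using assms by (subst card_permutations[of B]) (auto simp: B_def)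
  also have "card (P r) * card Q = card (P r \<times> Q)" by (simp add: card_cartesian_product)
  also have "\<dots> \<le> card (P (Suc r))"
  proof (rule card_inj_on_le[OF _ _ fin])
    show "inj_on (\<lambda>(\<tau>, \<rho>). \<tau> \<circ> \<rho>) (P r \<times> Q)"
    proof (rule inj_onI, clarify)
      fix \<tau> \<rho> \<tau>' \<rho>'
      assume in1: "\<tau> \<in> P r" "\<rho> \<in> Q" and in2: "\<tau>' \<in> P r" "\<rho>' \<in> Q" and eq: "\<tau> \<circ> \<rho> = \<tau>' \<circ> \<rho>'"
      have fixB: "\<upsilon> p = p" if "\<upsilon> \<in> P r" "p \<in> B" for \<upsilon> p
        using that by (auto simp: P_def B_def intro: permutes_not_in)
      have stay: "\<upsilon> p \<in> B \<longleftrightarrow> p \<in> B" "p \<notin> B \<Longrightarrow> \<upsilon> p = p" if "\<upsilon> \<in> Q" for \<upsilon> p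
        using that permutes_in_image[of \<upsilon> B] permutes_not_in[of \<upsilon> B] by (auto simp: Q_def)
      have "\<rho> p = \<rho>' p" for p
      proof (cases "p \<in> B")
        case True
        then show ?thesis
          using fun_cong[OF eq, of p] fixB[of \<tau> "\<rho> p"] fixB[of \<tau>' "\<rho>' p"] in1 in2 stay by simp
      qed (use stay(2)[OF in1(2)] stay(2)[OF in2(2)] in simp)
      moreover have "\<tau> p = \<tau>' p" for p
      proof (cases "p \<in> B")
        case False
        then show ?thesis
          using fun_cong[OF eq, of p] stay(2)[OF in1(2) False] stay(2)[OF in2(2) False] by simp
      qed (use fixB[OF in1(1)] fixB[OF in2(1)] in simp)
      ultimately show "\<tau> = \<tau>' \<and> \<rho> = \<rho>'" by auto
    qed
    show "(\<lambda>(\<tau>, \<rho>). \<tau> \<circ> \<rho>) ` (P r \<times> Q) \<subseteq> P (Suc r)"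
    proof clarify
      fix \<tau> \<rho> assume in1: "\<tau> \<in> P r" "\<rho> \<in> Q"
      have "\<tau> permutes {p \<in> D. blk p < Suc r}"
        using in1(1) by (auto simp: P_def intro: permutes_subset)
      moreover have "\<rho> permutes {p \<in> D. blk p < Suc r}"
        using in1(2) by (auto simp: Q_def B_def intro: permutes_subset)
      moreover have "blk (\<rho> p) = blk p" for p
        using in1(2) permutes_in_image[of \<rho> B p] permutes_not_in[of \<rho> B p]
        by (cases "p \<in> B") (auto simp: Q_def B_def)
      ultimately show "\<tau> \<circ> \<rho> \<in> P (Suc r)"
        using in1 by (auto simp: P_def intro: permutes_compose)
    qed
  qed
  finally show ?case by (simp add: P_def)
qed

text \<open>A copy \<open>A\<close> and a rearrangement \<open>\<tau>\<close> within layers give the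
  map \<open>nth_elem A \<circ> \<tau>\<close>, whose image recovers \<open>A\<close> and then
  \<open>\<tau>\<close>. It is admissible because \<open>block_hom\<close> leaves the order inside a
  layer free.\<close>

lemma card_copies_le_hom_sum:
  fixes \<pi> \<sigma> :: "nat \<Rightarrow> nat"
  assumes \<sigma>: "has_layer_sequence \<sigma> rs" and \<pi>: "\<pi> permutes {1..N}"
  defines "n \<equiv> sum_list rs"
  shows "real (card {A. A \<subseteq> {1..N} \<and> card A = n \<and> pattern \<pi> A = \<sigma>}) * (\<Prod>r\<leftarrow>rs. fact r)
    \<le> hom_sum (\<lambda>p q. p < q \<and> \<pi> p < \<pi> q) (\<lambda>p. layer_index rs (p - 1)) {1..n} {1..N} (\<lambda>_. 1)"
proof -
  define lt where "lt p q \<longleftrightarrow> p < q \<and> \<pi> p < \<pi> q" for p q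
  define blk where "blk p = layer_index rs (p - 1)" for p
  define \<A> where "\<A> = {A. A \<subseteq> {1..N} \<and> card A = n \<and> pattern \<pi> A = \<sigma>}"
  define P where "P = {\<tau>. \<tau> permutes {1..n} \<and> (\<forall>p. blk (\<tau> p) = blk p)}"
  define H where "H = {f \<in> {1..n} \<rightarrow>\<^sub>E {1..N}. block_hom lt blk {1..n} f}"
  have blk_less: "blk p < length rs" if "p \<in> {1..n}" for p
    using that layer_index_less[of "p - 1" rs] by (auto simp: blk_def n_def)
  have "(\<Prod>r\<leftarrow>rs. fact r) = (\<Prod>t<length rs. fact (rs ! t))"
    by (simp add: prod.list_conv_set_nth atLeast0LessThan)
  also have "\<dots> = (\<Prod>t<length rs. fact (card {p \<in> {1..n}. blk p = t}))"
    unfolding blk_def n_def by (intro prod.cong refl) (simp only: lessThan_iff card_layer_index_Suc)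
  also have "\<dots> \<le> card {\<tau>. \<tau> permutes {p \<in> {1..n}. blk p < length rs} \<and> (\<forall>p. blk (\<tau> p) = blk p)}"
    by (rule prod_fact_le_card_block_permutations) simp
  also have "{p \<in> {1..n}. blk p < length rs} = {1..n}" using blk_less by auto
  finally have "(\<Prod>r\<leftarrow>rs. fact r) \<le> card P" unfolding P_def .
  then have "card \<A> * (\<Prod>r\<leftarrow>rs. fact r) \<le> card \<A> * card P" by simp
  also have "\<dots> = card (\<A> \<times> P)" by (simp add: card_cartesian_product)
  also have "\<dots> \<le> card H"
  proof (rule card_inj_on_le)
    show "finite H" unfolding H_def by (rule finite_homs) auto
    have A: "finite A" "nth_elem A ` {1..n} = A" "inj_on (nth_elem A) {1..n}" if "A \<in> \<A>" for A
      using that nth_elem_bij[of A] finite_subset[of A "{1..N}"] by (auto simp: \<A>_def bij_betw_def)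
    have img: "restrict (nth_elem A \<circ> \<tau>) {1..n} ` {1..n} = A" if "A \<in> \<A>" "\<tau> \<in> P" for A \<tau>
    proof -
      have "\<tau> ` {1..n} = {1..n}" using that(2) by (auto simp: P_def dest: permutes_image)
      moreover have "restrict (nth_elem A \<circ> \<tau>) {1..n} ` {1..n} = nth_elem A ` (\<tau> ` {1..n})"
        by (auto simp: image_image)
      ultimately show ?thesis using A(2)[OF that(1)] by simp
    qed
    show "inj_on (\<lambda>(A, \<tau>). restrict (nth_elem A \<circ> \<tau>) {1..n}) (\<A> \<times> P)"
    proof (rule inj_onI, clarify)
      fix A \<tau> A' \<tau>'
      assume in1: "A \<in> \<A>" "\<tau> \<in> P" and in2: "A' \<in> \<A>" "\<tau>' \<in> P"
        and eq: "restrict (nth_elem A \<circ> \<tau>) {1..n} = restrict (nth_elem A' \<circ> \<tau>') {1..n}"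
      have "A = A'" using img[OF in1] img[OF in2] unfolding eq by (rule trans[OF sym])
      moreover have "\<tau> p = \<tau>' p" for p
      proof (cases "p \<in> {1..n}")
        case True
        then have "\<tau> p \<in> {1..n}" "\<tau>' p \<in> {1..n}"
          using in1 in2 by (auto simp: P_def permutes_in_image simp del: atLeastAtMost_iff)
        moreover have "nth_elem A (\<tau> p) = nth_elem A (\<tau>' p)"
          using fun_cong[OF eq, of p] True \<open>A = A'\<close> by simp
        ultimately show ?thesis using A(3)[OF in1(1)] by (auto dest: inj_onD)
      next
        case False
        then show ?thesis
          using in1 in2 permutes_not_in[of \<tau> _ p] permutes_not_in[of \<tau>' _ p] by (auto simp: P_def)
      qed
      ultimately show "A = A' \<and> \<tau> = \<tau>'" by auto
    qed
    show "(\<lambda>(A, \<tau>). restrict (nth_elem A \<circ> \<tau>) {1..n}) ` (\<A> \<times> P) \<subseteq> H"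
    proof clarify
      fix A \<tau> assume in1: "A \<in> \<A>" "\<tau> \<in> P"
      have cardA: "card A = n" "A \<subseteq> {1..N}" "pattern \<pi> A = \<sigma>" using in1 by (auto simp: \<A>_def)
      have inj: "inj_on \<pi> A" using \<pi> permutes_inj_on by blast
      have \<tau>: "\<tau> p \<in> {1..n}" "blk (\<tau> p) = blk p" if "p \<in> {1..n}" for p
        using that in1(2) by (auto simp: P_def permutes_in_image simp del: atLeastAtMost_iff)
      have order: "\<pi> (nth_elem A i) < \<pi> (nth_elem A j) \<longleftrightarrow> blk i \<noteq> blk j" "nth_elem A i < nth_elem A j"
        if "1 \<le> i" "i < j" "j \<le> n" for i j
        using pattern_less_iff[OF A(1)[OF in1(1)] inj, of i j] cardA that
          layer_sequence_less_iff[OF \<sigma>, of i j] nth_elem_strict_mono[OF A(1)[OF in1(1)], of i j]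
        by (auto simp: blk_def n_def)
      have blkmono: "i < j" if "blk i < blk j" for i j
        using layer_index_mono[of "j - 1" "i - 1" rs] that by (force simp: blk_def)
      have hom: "(blk i < blk j \<longrightarrow> lt (nth_elem A i) (nth_elem A j)) \<and>
          (blk i = blk j \<longrightarrow> \<not> lt (nth_elem A i) (nth_elem A j))" if "i \<in> {1..n}" "j \<in> {1..n}" for i j
      proof (cases i j rule: linorder_cases)
        case less
        then show ?thesis using order[of i j] that by (auto simp: lt_def)
      next
        case greater
        then show ?thesis using order(2)[of j i] blkmono[of i j] that by (auto simp: lt_def)
      qed (auto simp: lt_def)
      have "block_hom lt blk {1..n} (restrict (nth_elem A \<circ> \<tau>) {1..n})"
        unfolding block_hom_def using hom[OF \<tau>(1) \<tau>(1)] \<tau>(2) by simp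
      moreover have "nth_elem A (\<tau> p) \<in> {1..N}" if "p \<in> {1..n}" for p
        using A(2)[OF in1(1)] \<tau>(1)[OF that] cardA(2) by blast
      ultimately show "restrict (nth_elem A \<circ> \<tau>) {1..n} \<in> H"
        by (simp add: H_def)
    qed
  qed
  finally have "real (card \<A> * (\<Prod>r\<leftarrow>rs. fact r)) \<le> real (card H)" by (simp only: of_nat_le_iff)
  moreover have "real (\<Prod>r\<leftarrow>rs. fact r) = (\<Prod>r\<leftarrow>rs. fact r)"
    by (induction rs) auto
  ultimately show ?thesis
    unfolding hom_sum_def \<A>_def H_def lt_def[abs_def] blk_def[abs_def] by simp
qed

text \<open>Unit weights have total \<open>N\<close>, and moving weight preserves this total.
  Antilayer entries contribute only \<open>fact 1\<close>, and the antilayer mass starts at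
  0.\<close>

lemma card_copies_le:
  fixes \<pi> \<sigma> :: "nat \<Rightarrow> nat"
  assumes ls: "ls \<noteq> []" "sorted ls" "2 \<le> a" "\<And>l. l \<in> set ls \<Longrightarrow> a \<le> l"
    and len: "real (length ls) \<le> 2 ^ a - real a - 1"
    and \<sigma>: "has_layer_sequence \<sigma> (replicate a 1 @ ls)" and \<pi>: "\<pi> permutes {1..N}"
  shows "real (card {A. A \<subseteq> {1..N} \<and> card A = a + sum_list ls \<and> pattern \<pi> A = \<sigma>}) * (\<Prod>l\<leftarrow>ls. fact l)
    \<le> layered_const a ls * real N ^ (a + sum_list ls)"
proof -
  define rs where "rs = replicate a 1 @ ls"
  define n where "n = a + sum_list ls"
  define lt where "lt p q \<longleftrightarrow> p < q \<and> \<pi> p < \<pi> q" for p q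
  define blk where "blk p = layer_index rs (p - 1)" for p
  have n: "sum_list rs = n" by (simp add: rs_def n_def sum_list_replicate)
  have pos: "0 < r" if "r \<in> set rs" for r
    using that ls(3) ls(4)[of r] by (auto simp: rs_def)
  have "real (card {A. A \<subseteq> {1..N} \<and> card A = n \<and> pattern \<pi> A = \<sigma>}) * (\<Prod>r\<leftarrow>rs. fact r)
    \<le> hom_sum lt blk {1..n} {1..N} (\<lambda>_. 1)"
    using card_copies_le_hom_sum[OF \<sigma> \<pi>] unfolding rs_def[symmetric] n lt_def[abs_def] blk_def[abs_def] .
  also obtain u where u: "\<And>v. v \<in> {1..N} \<Longrightarrow> 0 \<le> u v" "sum u {1..N} = (\<Sum>v\<in>{1..N}. 1)"
    "hom_sum lt blk {1..n} {1..N} (\<lambda>_. 1) \<le> hom_sum lt blk {1..n} {1..N} u"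
    "\<And>x y. x \<in> {1..N} \<Longrightarrow> y \<in> {1..N} \<Longrightarrow> u x \<noteq> 0 \<Longrightarrow> u y \<noteq> 0 \<Longrightarrow> x \<noteq> y \<Longrightarrow> lt x y \<or> lt y x"
    by (rule hom_sum_chain_support[of "{1..n}" "{1..N}" lt "\<lambda>_. 1" blk]) (auto simp: lt_def)
  note u(3)
  also have "hom_sum lt blk {1..n} {1..N} u = hom_sum lt blk {1..n} {v \<in> {1..N}. u v \<noteq> 0} u"
    by (rule hom_sum_support) auto
  also have "\<dots> \<le> mqs rs (map u (sorted_list_of_set {v \<in> {1..N}. u v \<noteq> 0}))"
  proof -
    define vs where "vs = sorted_list_of_set {v \<in> {1..N}. u v \<noteq> 0}"
    have set: "set vs = {v \<in> {1..N}. u v \<noteq> 0}" by (simp add: vs_def)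
    have "sorted_wrt (<) vs" by (simp add: vs_def)
    then have "sorted_wrt lt vs"
    proof (rule sorted_wrt_mono_rel[rotated])
      fix x y assume "x \<in> set vs" "y \<in> set vs" "x < y"
      then show "lt x y" using u(4)[of x y] by (auto simp: set lt_def)
    qed
    have fibre: "card {p \<in> {1..n}. blk p = t} = rs ! t" if "t < length rs" for t
      using card_layer_index_Suc[OF that] by (simp add: n blk_def)
    have "hom_sum lt blk {p \<in> {1..n}. 0 \<le> blk p} (set vs) u
        \<le> mqs (map (\<lambda>t. card {p \<in> {1..n}. blk p = t}) [0..<length rs]) (map u vs)"
    proof (rule hom_sum_chain_le)
      fix t assume "t < length rs"
      then have "0 < card {p \<in> {1..n}. blk p = t}" using fibre pos by simp
      then show "\<exists>p\<in>{1..n}. blk p = t" unfolding card_gt_0_iff by blast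
    next
      fix p assume "p \<in> {1..n}"
      then show "blk p < length rs" using layer_index_less[of "p - 1" rs] by (auto simp: blk_def n)
    next
      fix v assume "v \<in> set vs"
      then show "0 \<le> u v" using u(1) by (simp add: set)
    qed (use \<open>sorted_wrt lt vs\<close> in \<open>auto simp: lt_def\<close>)
    also have "map (\<lambda>t. card {p \<in> {1..n}. blk p = t}) [0..<length rs] = map (\<lambda>t. rs ! t) [0..<length rs]"
      using fibre by (intro map_cong) auto
    also have "\<dots> = rs" by (rule map_nth)
    finally have "hom_sum lt blk {p \<in> {1..n}. 0 \<le> blk p} (set vs) u \<le> mqs rs (map u vs)" .
    moreover have "{p \<in> {1..n}. 0 \<le> blk p} = {1..n}" by auto
    ultimately show ?thesis unfolding set by (simp only: vs_def)
  qed
  also have "\<dots> = layered_sum a ls 0 (map u (sorted_list_of_set {v \<in> {1..N}. u v \<noteq> 0}))"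
    by (simp add: layered_sum_antilayer_0 rs_def)
  also have "\<dots> \<le> layered_const a ls *
      (0 + sum_list (map u (sorted_list_of_set {v \<in> {1..N}. u v \<noteq> 0}))) ^ (a + sum_list ls)"
    using u(1) by (intro layered_sum_le ls len) auto
  also have "sum_list (map u (sorted_list_of_set {v \<in> {1..N}. u v \<noteq> 0})) = sum u {v \<in> {1..N}. u v \<noteq> 0}"
    by (simp add: sum.distinct_set_conv_list[symmetric])
  also have "\<dots> = sum u {1..N}"
    by (rule sum.mono_neutral_left) auto
  also have "\<dots> = real N" using u(2) by simp
  finally show ?thesis by (simp add: n_def rs_def)
qed

section \<open>Lower bound on the number of copies\<close>

text \<open>For monotone \<open>h\<close>, \<open>h j \<le> t\<close> holds iff at least
  \<open>j\<close> arguments have value at most \<open>t\<close>, and that number is a sum of fibre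
  sizes.\<close>

lemma mono_fibres_eq:
  fixes f g :: "nat \<Rightarrow> nat"
  assumes f: "\<And>i j. 1 \<le> i \<Longrightarrow> i \<le> j \<Longrightarrow> j \<le> n \<Longrightarrow> f i \<le> f j"
    and g: "\<And>i j. 1 \<le> i \<Longrightarrow> i \<le> j \<Longrightarrow> j \<le> n \<Longrightarrow> g i \<le> g j"
    and fibres: "\<And>t. card {i \<in> {1..n}. f i = t} = card {i \<in> {1..n}. g i = t}"
    and j: "j \<in> {1..n}"
  shows "f j = g j"
proof -
  have le: "h j \<le> t \<longleftrightarrow> j \<le> card {i \<in> {1..n}. h i \<le> t}"
    if h: "\<And>i j. 1 \<le> i \<Longrightarrow> i \<le> j \<Longrightarrow> j \<le> n \<Longrightarrow> h i \<le> h j" for h :: "nat \<Rightarrow> nat" and t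
  proof
    assume t: "h j \<le> t"
    have "{1..j} \<subseteq> {i \<in> {1..n}. h i \<le> t}"
    proof
      fix i assume "i \<in> {1..j}"
      then show "i \<in> {i \<in> {1..n}. h i \<le> t}" using h[of i j] t j by auto
    qed
    then have "card {1..j} \<le> card {i \<in> {1..n}. h i \<le> t}" by (intro card_mono) auto
    then show "j \<le> card {i \<in> {1..n}. h i \<le> t}" by simp
  next
    assume c: "j \<le> card {i \<in> {1..n}. h i \<le> t}"
    show "h j \<le> t"
    proof (rule ccontr)
      assume t: "\<not> h j \<le> t"
      have "{i \<in> {1..n}. h i \<le> t} \<subseteq> {1..<j}"
      proof
        fix i assume i: "i \<in> {i \<in> {1..n}. h i \<le> t}"
        then show "i \<in> {1..<j}" using h[of j i] t j by (cases "j \<le> i") auto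
      qed
      then have "card {i \<in> {1..n}. h i \<le> t} \<le> card {1..<j}" by (intro card_mono) auto
      also have "\<dots> < j" using j by auto
      finally show False using c by simp
    qed
  qed
  have "card {i \<in> {1..n}. h i \<le> t} = (\<Sum>s\<le>t. card {i \<in> {1..n}. h i = s})" for h :: "nat \<Rightarrow> nat" and t
  proof -
    have "{i \<in> {1..n}. h i \<le> t} = (\<Union>s\<le>t. {i \<in> {1..n}. h i = s})" by auto
    then show ?thesis by (simp only:) (subst card_UN_disjoint; auto)
  qed
  then have "f j \<le> t \<longleftrightarrow> g j \<le> t" for t
    using le[of f t] le[of g t] f g fibres by simp
  then show ?thesis by (meson order_antisym order_refl)
qed

text \<open>In the list \<open>a # ls\<close> the whole antilayer has index 0; values increase
  inside it and decrease inside every other region.\<close>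

lemma antilayer_sequence_less_iff:
  assumes \<sigma>: "has_layer_sequence \<sigma> (replicate a 1 @ ls)" and "1 \<le> p" "p < q" "q \<le> a + sum_list ls"
  shows "\<sigma> p < \<sigma> q \<longleftrightarrow> layer_index (a # ls) (p - 1) = 0 \<or>
    layer_index (a # ls) (p - 1) \<noteq> layer_index (a # ls) (q - 1)"
  using layer_sequence_less_iff[OF \<sigma>, of p q] assms(2-4)
  by (auto simp: sum_list_replicate layer_index_replicate[unfolded One_nat_def])

text \<open>
  Both antilayers are treated as a single region, numbered \<open>0\<close>; copies arise by choosing in every
  region of \<open>\<pi>\<close> as many positions as the corresponding region of \<open>\<sigma>\<close> has.
\<close>

lemma card_copies_ge:
  fixes \<pi> \<sigma> :: "nat \<Rightarrow> nat"
  assumes \<sigma>: "has_layer_sequence \<sigma> (replicate a 1 @ ls)"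
    and \<pi>: "has_layer_sequence \<pi> (replicate b 1 @ ms @ rest)" and len: "length ms = length ls"
  defines "N \<equiv> b + sum_list ms + sum_list rest"
  shows "(\<Prod>t<Suc (length ls). ((b # ms) ! t) choose ((a # ls) ! t))
    \<le> card {A. A \<subseteq> {1..N} \<and> card A = a + sum_list ls \<and> pattern \<pi> A = \<sigma>}"
proof -
  define n where "n = a + sum_list ls"
  define k where "k = length ls"
  define reg where "reg p = layer_index (a # ls) (p - 1)" for p
  define Reg where "Reg p = layer_index (b # ms @ rest) (p - 1)" for p
  define R where "R t = {p \<in> {1..N}. Reg p = t}" for t
  define X where "X t = {S. S \<subseteq> R t \<and> card S = (a # ls) ! t}" for t
  have N: "sum_list (b # ms @ rest) = N" by (simp add: N_def)
  have n: "sum_list (a # ls) = n" by (simp add: n_def)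
  have finR: "finite (R t)" for t by (simp add: R_def)
  have "(b # ms @ rest) ! t = (b # ms) ! t" if "t < Suc k" for t
    using that len by (cases t) (auto simp: nth_append k_def)
  then have "card (R t) = (b # ms) ! t" if "t < Suc k" for t
    using card_layer_index_Suc[of t "b # ms @ rest"] that len unfolding R_def Reg_def N k_def
    by simp
  then have "card (X t) = ((b # ms) ! t) choose ((a # ls) ! t)" if "t < Suc k" for t
    using n_subsets[OF finR, of t "(a # ls) ! t"] that by (simp add: X_def)
  then have "(\<Prod>t<Suc k. ((b # ms) ! t) choose ((a # ls) ! t)) = (\<Prod>t<Suc k. card (X t))"
    by (intro prod.cong) auto
  also have "\<dots> = card (PiE {..<Suc k} X)"
    by (simp add: card_PiE)
  also have "\<dots> \<le> card {A. A \<subseteq> {1..N} \<and> card A = n \<and> pattern \<pi> A = \<sigma>}"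
  proof (rule card_inj_on_le)
    show "finite {A. A \<subseteq> {1..N} \<and> card A = n \<and> pattern \<pi> A = \<sigma>}"
      by (rule finite_subset[of _ "Pow {1..N}"]) auto
    have sub: "F t \<subseteq> R t" "card (F t) = (a # ls) ! t" if "F \<in> PiE {..<Suc k} X" "t < Suc k" for F t
      using PiE_mem[OF that(1), of t] that(2) by (auto simp: X_def)
    have part: "{p \<in> (\<Union>t<Suc k. F t). Reg p = t} = F t" if "F \<in> PiE {..<Suc k} X" "t < Suc k" for F t
    proof
      show "{p \<in> (\<Union>t<Suc k. F t). Reg p = t} \<subseteq> F t"
      proof
        fix p assume "p \<in> {p \<in> (\<Union>t<Suc k. F t). Reg p = t}"
        then obtain u where u: "u < Suc k" "p \<in> F u" "Reg p = t" by auto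
        then have "Reg p = u" using sub(1)[OF that(1), of u] by (auto simp: R_def)
        then show "p \<in> F t" using u by simp
      qed
      show "F t \<subseteq> {p \<in> (\<Union>t<Suc k. F t). Reg p = t}"
        using sub(1)[OF that] that(2) by (auto simp: R_def)
    qed
    show "inj_on (\<lambda>F. \<Union>t<Suc k. F t) (PiE {..<Suc k} X)"
    proof (rule inj_onI)
      fix F G assume FG: "F \<in> PiE {..<Suc k} X" "G \<in> PiE {..<Suc k} X" "(\<Union>t<Suc k. F t) = (\<Union>t<Suc k. G t)"
      show "F = G"
      proof (rule PiE_ext[OF FG(1,2)])
        fix t assume "t \<in> {..<Suc k}"
        then show "F t = G t" using part[OF FG(1), of t] part[OF FG(2), of t] FG(3) by simp
      qed
    qed
    show "(\<lambda>F. \<Union>t<Suc k. F t) ` PiE {..<Suc k} X \<subseteq> {A. A \<subseteq> {1..N} \<and> card A = n \<and> pattern \<pi> A = \<sigma>}"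
    proof (rule image_subsetI)
      fix F assume F: "F \<in> PiE {..<Suc k} X"
      define A where "A = (\<Union>t<Suc k. F t)"
      have AN: "A \<subseteq> {1..N}"
      proof
        fix p assume "p \<in> A"
        then obtain u where "u < Suc k" "p \<in> F u" by (auto simp: A_def)
        then show "p \<in> {1..N}" using sub(1)[OF F, of u] by (auto simp: R_def)
      qed
      then have finA: "finite A" by (rule finite_subset) simp
      have finF: "finite (F t)" if "t < Suc k" for t
        using sub(1)[OF F that] finR by (rule finite_subset)
      have "card A = (\<Sum>t<Suc k. card (F t))"
        unfolding A_def
      proof (rule card_UN_disjoint)
        show "\<forall>i\<in>{..<Suc k}. \<forall>j\<in>{..<Suc k}. i \<noteq> j \<longrightarrow> F i \<inter> F j = {}"
        proof (intro ballI impI)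
          fix i j assume "i \<in> {..<Suc k}" "j \<in> {..<Suc k}" "i \<noteq> j"
          then show "F i \<inter> F j = {}"
            using sub(1)[OF F, of i] sub(1)[OF F, of j] by (auto simp: R_def)
        qed
      qed (use finF in auto)
      also have "\<dots> = (\<Sum>t<Suc k. (a # ls) ! t)"
        using sub(2)[OF F] by (intro sum.cong) auto
      also have "\<dots> = n"
        unfolding n[symmetric] by (simp only: sum_list_sum_nth k_def atLeast0LessThan list.size add_Suc_right add_0_right)
      finally have cardA: "card A = n" .
      have bij: "bij_betw (nth_elem A) {1..n} A" using nth_elem_bij[OF finA] cardA by simp
      \<comment> \<open>The chosen set has in each region of \<open>\<pi>\<close> the size of the
        matching region of \<open>\<sigma>\<close>, and region numbers are monotone, so the
        \<open>j\<close>-th chosen position lies in the region of \<open>j\<close>.\<close>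
      have reg_eq: "Reg (nth_elem A j) = reg j" if "j \<in> {1..n}" for j
      proof (rule mono_fibres_eq[OF _ _ _ that])
        fix i j assume ij: "1 \<le> i" "i \<le> j" "j \<le> n"
        show "Reg (nth_elem A i) \<le> Reg (nth_elem A j)"
        proof (cases "i = j")
          case False
          then have "nth_elem A i < nth_elem A j"
            using ij cardA by (intro nth_elem_strict_mono finA) auto
          then show ?thesis unfolding Reg_def by (intro layer_index_mono) auto
        qed simp
        show "reg i \<le> reg j" unfolding reg_def using ij by (intro layer_index_mono) auto
      next
        fix t
        have "bij_betw (nth_elem A) {i \<in> {1..n}. Reg (nth_elem A i) = t} {p \<in> A. Reg p = t}"
        proof (rule bij_betw_subset[OF bij])
          have "p \<in> nth_elem A ` {i \<in> {1..n}. Reg (nth_elem A i) = t}" if "p \<in> A" "Reg p = t" for p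
          proof -
            have "p \<in> nth_elem A ` {1..n}" using bij that(1) by (simp only: bij_betw_imp_surj_on)
            then show ?thesis using that(2) by blast
          qed
          moreover have "nth_elem A i \<in> A" if "i \<in> {1..n}" for i
            using bij that by (rule bij_betwE[THEN bspec])
          ultimately show "nth_elem A ` {i \<in> {1..n}. Reg (nth_elem A i) = t} = {p \<in> A. Reg p = t}"
            by blast
        qed auto
        then have 1: "card {i \<in> {1..n}. Reg (nth_elem A i) = t} = card {p \<in> A. Reg p = t}"
          by (rule bij_betw_same_card)
        show "card {i \<in> {1..n}. Reg (nth_elem A i) = t} = card {i \<in> {1..n}. reg i = t}"
        proof (cases "t < Suc k")
          case True
          then have "card {i \<in> {1..n}. reg i = t} = (a # ls) ! t"
            using card_layer_index_Suc[of t "a # ls"] unfolding reg_def n k_def by simp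
          then show ?thesis using 1 part[OF F True] sub(2)[OF F True] by (simp add: A_def)
        next
          case False
          \<comment> \<open>Regions beyond \<open>k\<close> come from \<open>rest\<close>, where
            nothing is chosen.\<close>
          have "{p \<in> A. Reg p = t} = {}"
          proof -
            have "Reg p < Suc k" if "p \<in> A" for p
            proof -
              obtain u where "u < Suc k" "p \<in> F u" using \<open>p \<in> A\<close> by (auto simp: A_def)
              then show ?thesis using sub(1)[OF F, of u] by (auto simp: R_def)
            qed
            then show ?thesis using False by auto
          qed
          moreover have "reg i < Suc k" if "i \<in> {1..n}" for i
            using layer_index_less[of "i - 1" "a # ls"] that n by (auto simp: reg_def k_def)
          then have "{i \<in> {1..n}. reg i = t} = {}" using False by auto
          ultimately show ?thesis using 1 by (simp only: card.empty)
        qed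
      qed
      have \<pi>p: "\<pi> permutes {1..N}"
        using \<pi> by (simp add: has_layer_sequence_def N_def sum_list_replicate add.assoc)
      have \<sigma>p: "\<sigma> permutes {1..n}"
        using \<sigma> by (simp add: has_layer_sequence_def n_def sum_list_replicate)
      have "pattern \<pi> A = \<sigma>"
      proof (rule pattern_eqI)
        show "inj_on \<pi> A" using \<pi>p permutes_inj_on by blast
        show "\<sigma> permutes {1..card A}" using \<sigma>p cardA by simp
        fix i j assume ij: "1 \<le> i" "i < j" "j \<le> card A"
        have "nth_elem A i \<in> A" "nth_elem A j \<in> A"
          using bij_betwE[OF bij, THEN bspec, of i] bij_betwE[OF bij, THEN bspec, of j] ij cardA by auto
        then have "1 \<le> nth_elem A i" "nth_elem A j \<le> b + sum_list (ms @ rest)"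
          using AN by (auto simp: N_def)
        then have "\<pi> (nth_elem A i) < \<pi> (nth_elem A j) \<longleftrightarrow>
            Reg (nth_elem A i) = 0 \<or> Reg (nth_elem A i) \<noteq> Reg (nth_elem A j)"
          unfolding Reg_def using ij
          by (intro antilayer_sequence_less_iff[OF \<pi>] nth_elem_strict_mono finA) auto
        also have "\<dots> \<longleftrightarrow> reg i = 0 \<or> reg i \<noteq> reg j"
          using reg_eq[of i] reg_eq[of j] ij cardA by simp
        also have "\<dots> \<longleftrightarrow> \<sigma> i < \<sigma> j"
          unfolding reg_def using ij cardA
          by (intro antilayer_sequence_less_iff[OF \<sigma>, symmetric]) (auto simp: n_def)
        finally show "\<pi> (nth_elem A i) < \<pi> (nth_elem A j) \<longleftrightarrow> \<sigma> i < \<sigma> j" .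
      qed (rule finA)
      then show "(\<Union>t<Suc k. F t) \<in> {A. A \<subseteq> {1..N} \<and> card A = n \<and> pattern \<pi> A = \<sigma>}"
        using AN cardA by (simp add: A_def)
    qed
  qed
  finally show ?thesis by (simp only: n_def k_def)
qed


section \<open>The packing density\<close>

text \<open>The binomial is a product of \<open>m\<close> factors \<open>g N - i\<close> over
  \<open>fact m\<close>; each factor divided by \<open>N\<close> tends to \<open>c\<close>.\<close>

lemma tendsto_binomial_ratio:
  fixes g :: "nat \<Rightarrow> nat" and c :: real
  assumes "(\<lambda>N. real (g N) / real N) \<longlonglongrightarrow> c"
  shows "(\<lambda>N. real (g N choose m) / real N ^ m) \<longlonglongrightarrow> c ^ m / fact m"
proof -
  have "(\<lambda>N. (\<Prod>i = 0..<m. real (g N) / real N - real i / real N) / fact m)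
      \<longlonglongrightarrow> (\<Prod>i = 0..<m. c - 0) / fact m"
    by (intro tendsto_intros assms lim_const_over_n) simp
  moreover have "\<forall>\<^sub>F N in sequentially. (\<Prod>i = 0..<m. real (g N) / real N - real i / real N) / fact m
      = real (g N choose m) / real N ^ m"
    by (simp add: binomial_gbinomial gbinomial_prod_rev prod_dividef flip: diff_divide_distrib)
  ultimately show ?thesis
    by (simp add: filterlim_cong[OF refl refl])
qed

lemma tendsto_div_ratio:
  assumes "0 < (n::nat)"
  shows "(\<lambda>N. real (l * (N div n)) / real N) \<longlonglongrightarrow> real l / real n"
proof -
  have "(\<lambda>N. real (N mod n) / real N) \<longlonglongrightarrow> 0"
  proof (rule tendsto_sandwich[of "\<lambda>_. 0" _ _ "\<lambda>N. real n / real N"])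
    show "\<forall>\<^sub>F N in sequentially. real (N mod n) / real N \<le> real n / real N"
      using assms by (intro always_eventually allI divide_right_mono) (auto simp: less_imp_le)
    show "(\<lambda>N. real n / real N) \<longlonglongrightarrow> 0" by (rule lim_const_over_n)
  qed auto
  then have "(\<lambda>N. real l / real n * (1 - real (N mod n) / real N)) \<longlonglongrightarrow> real l / real n * (1 - 0)"
    by (intro tendsto_intros)
  moreover have "\<forall>\<^sub>F N in sequentially.
      real l / real n * (1 - real (N mod n) / real N) = real (l * (N div n)) / real N"
    using eventually_gt_at_top[of 0]
  proof eventually_elim
    case (elim N)
    have "real N = real n * real (N div n) + real (N mod n)"
      by (simp flip: of_nat_mult of_nat_add)
    then have "real N - real (N mod n) = real n * real (N div n)" by simp
    then have "1 - real (N mod n) / real N = real n * real (N div n) / real N"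
      using elim by (simp add: field_simps)
    then show ?case using assms by simp
  qed
  ultimately show ?thesis
    by (simp add: filterlim_cong[OF refl refl])
qed

lemma prod_list_power_divide:
  "(\<Prod>e\<leftarrow>es. (real e / s) ^ e / fact e) = (\<Prod>e\<leftarrow>es. real e ^ e / fact e) / s ^ sum_list es"
  by (induction es) (auto simp: power_add power_divide)

lemma packing_density_layered:
  assumes ls: "ls \<noteq> []" "sorted ls" "2 \<le> a" "\<And>l. l \<in> set ls \<Longrightarrow> a \<le> l"
    and len: "real (length ls) \<le> 2 ^ a - real a - 1"
    and \<sigma>: "has_layer_sequence \<sigma> (replicate a 1 @ ls)"
  defines "n \<equiv> a + sum_list ls"
  shows "packing_density n \<sigma> = fact n / real n ^ n * (\<Prod>e\<leftarrow>a # ls. real e ^ e / fact e)"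
proof -
  define k where "k = length ls"
  define es where "es = a # ls"
  define M where "M N = Max {pattern_density n \<sigma> N \<pi> | \<pi>. \<pi> permutes {1..N}}" for N
  define V where "V = fact n / real n ^ n * (\<Prod>e\<leftarrow>es. real e ^ e / fact e)"
  have n0: "0 < n" using ls by (simp add: n_def)
  have pos: "0 < l" if "l \<in> set ls" for l using ls(3) ls(4)[OF that] by simp
  have sum_es: "sum_list es = n" "length es = Suc k" by (simp_all add: es_def n_def k_def)
  have fin: "finite {pattern_density n \<sigma> N \<pi> | \<pi>. \<pi> permutes {1..N}}" for N
    using finite_permutations[of "{1..N}"] by simp
  have mem: "pattern_density n \<sigma> N \<pi> \<in> {pattern_density n \<sigma> N \<pi> | \<pi>. \<pi> permutes {1..N}}"
    if "\<pi> permutes {1..N}" for N \<pi> using that by blast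
  have choose: "(\<lambda>N. real (N choose n) / real N ^ n) \<longlonglongrightarrow> 1 ^ n / fact n"
    by (rule tendsto_binomial_ratio) (rule tendsto_eventually, auto intro!: eventually_gt_at_top[of 0, THEN eventually_mono])
  \<comment> \<open>This holds even for \<open>N < n\<close>, where both sides are 0 because
    division by zero gives 0.\<close>
  have upper: "M N \<le> layered_const a ls / (\<Prod>l\<leftarrow>ls. fact l) / (real (N choose n) / real N ^ n)" for N
    unfolding M_def
  proof (rule Max.boundedI[OF fin])
    show "{pattern_density n \<sigma> N \<pi> | \<pi>. \<pi> permutes {1..N}} \<noteq> {}"
      using permutes_id by blast
    fix d assume "d \<in> {pattern_density n \<sigma> N \<pi> | \<pi>. \<pi> permutes {1..N}}"
    then obtain \<pi> where \<pi>: "\<pi> permutes {1..N}" "d = pattern_density n \<sigma> N \<pi>" by blast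
    have F: "0 < (\<Prod>l\<leftarrow>ls. fact l :: real)" by (induction ls) auto
    have "real (card {A. A \<subseteq> {1..N} \<and> card A = n \<and> pattern \<pi> A = \<sigma>}) \<le>
        layered_const a ls / (\<Prod>l\<leftarrow>ls. fact l) * real N ^ n"
      using card_copies_le[OF ls len \<sigma> \<pi>(1)] F by (simp add: n_def field_simps)
    then have "d \<le> layered_const a ls / (\<Prod>l\<leftarrow>ls. fact l) * real N ^ n / real (N choose n)"
      unfolding \<pi>(2) pattern_density_def by (rule divide_right_mono) simp
    then show "d \<le> layered_const a ls / (\<Prod>l\<leftarrow>ls. fact l) / (real (N choose n) / real N ^ n)"
      by simp
  qed
  define L where "L N = (\<Prod>t<Suc k. real ((es ! t * (N div n)) choose (es ! t)) / real N ^ (es ! t))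
      / (real (N choose n) / real N ^ n)" for N
  have lower: "L N \<le> M N" if N: "n \<le> N" for N
  proof -
    define q where "q = N div n"
    \<comment> \<open>Each region of \<open>\<sigma>\<close> is enlarged by the factor
      \<open>q\<close>; the fewer than \<open>n\<close> leftover positions become singleton layers
      at the end and do not affect the limit.\<close>
    define rest where "rest = replicate (N - n * q) (1::nat)"
    have q: "0 < q" using N n0 by (simp add: q_def div_greater_zero_iff)
    have nq: "n * q \<le> N" by (simp add: q_def)
    define rs where "rs = replicate (a * q) 1 @ map (\<lambda>l. l * q) ls @ rest"
    have sum_q: "sum_list (map (\<lambda>l. l * q) ls) = sum_list ls * q"
      by (simp add: sum_list_mult_const)
    have sum_rs: "a * q + sum_list (map (\<lambda>l. l * q) ls) + sum_list rest = N"
      using nq by (simp add: sum_q rest_def sum_list_replicate n_def distrib_right)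
    have "\<forall>r\<in>set rs. 0 < r" using q pos by (auto simp: rs_def rest_def)
    then obtain \<pi> where \<pi>: "has_layer_sequence \<pi> rs" using has_layer_sequence_ex1 by blast
    have "sum_list rs = N" using sum_rs by (simp add: rs_def sum_list_replicate)
    then have \<pi>p: "\<pi> permutes {1..N}" using \<pi> by (simp add: has_layer_sequence_def)
    have "(\<Prod>t<Suc k. ((a * q # map (\<lambda>l. l * q) ls) ! t) choose (es ! t))
        \<le> card {A. A \<subseteq> {1..N} \<and> card A = n \<and> pattern \<pi> A = \<sigma>}"
      using card_copies_ge[OF \<sigma> \<pi>[unfolded rs_def]] unfolding sum_rs n_def[symmetric] es_def k_def by simp
    moreover have "(a * q # map (\<lambda>l. l * q) ls) ! t = es ! t * q" if "t < Suc k" for t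
      using that by (cases t) (auto simp: es_def k_def)
    ultimately have "(\<Prod>t<Suc k. (es ! t * q) choose (es ! t))
        \<le> card {A. A \<subseteq> {1..N} \<and> card A = n \<and> pattern \<pi> A = \<sigma>}" by simp
    then have "real (\<Prod>t<Suc k. (es ! t * q) choose (es ! t)) / real (N choose n) \<le> pattern_density n \<sigma> N \<pi>"
      unfolding pattern_density_def by (intro divide_right_mono) (simp_all only: of_nat_le_iff of_nat_0_le_iff)
    also have "\<dots> \<le> M N" unfolding M_def by (rule Max_ge[OF fin mem[OF \<pi>p]])
    also have "real (\<Prod>t<Suc k. (es ! t * q) choose (es ! t)) / real (N choose n) = L N"
    proof -
      have "(\<Prod>t<Suc k. real N ^ (es ! t)) = real N ^ n"
        unfolding power_sum[symmetric] using sum_es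
        by (simp only: sum_list_sum_nth atLeast0LessThan)
      then have "L N = (\<Prod>t<Suc k. real ((es ! t * q) choose (es ! t))) / real N ^ n / (real (N choose n) / real N ^ n)"
        unfolding L_def q_def[symmetric] prod_dividef by (simp only:)
      then show ?thesis using N n0 by (simp add: of_nat_prod del: prod.lessThan_Suc)
    qed
    finally show ?thesis .
  qed
  have "L \<longlonglongrightarrow> (\<Prod>t<Suc k. (real (es ! t) / real n) ^ (es ! t) / fact (es ! t)) / (1 ^ n / fact n)"
    unfolding L_def
    by (intro tendsto_divide tendsto_prod choose tendsto_binomial_ratio tendsto_div_ratio n0) simp
  also have "(\<Prod>t<Suc k. (real (es ! t) / real n) ^ (es ! t) / fact (es ! t)) =
      (\<Prod>e\<leftarrow>es. (real e / real n) ^ e / fact e)"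
    by (simp only: prod.list_conv_set_nth length_map sum_es atLeast0LessThan) (intro prod.cong; simp add: sum_es)
  also have "\<dots> / (1 ^ n / fact n) = V"
    by (simp add: prod_list_power_divide sum_es V_def)
  finally have L: "L \<longlonglongrightarrow> V" .
  have "(\<lambda>N. layered_const a ls / (\<Prod>l\<leftarrow>ls. fact l) / (real (N choose n) / real N ^ n))
      \<longlonglongrightarrow> layered_const a ls / (\<Prod>l\<leftarrow>ls. fact l) / (1 ^ n / fact n)"
    by (intro tendsto_divide tendsto_const choose) simp
  also have "layered_const a ls / (\<Prod>l\<leftarrow>ls. fact l) / (1 ^ n / fact n) = V"
  proof -
    have "(\<Prod>l\<leftarrow>ls. real l ^ l) / (\<Prod>l\<leftarrow>ls. fact l) = (\<Prod>l\<leftarrow>ls. real l ^ l / fact l)"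
      by (induction ls) (auto simp flip: times_divide_times_eq)
    moreover have "layered_const a ls / (\<Prod>l\<leftarrow>ls. fact l) / (1 ^ n / fact n) =
        fact n / real n ^ n * (real a ^ a / fact a * ((\<Prod>l\<leftarrow>ls. real l ^ l) / (\<Prod>l\<leftarrow>ls. fact l)))"
      by (simp add: layered_const_def mult_ac flip: n_def)
    ultimately show ?thesis by (simp only: V_def es_def list.map prod_list.Cons)
  qed
  finally have U: "(\<lambda>N. layered_const a ls / (\<Prod>l\<leftarrow>ls. fact l) / (real (N choose n) / real N ^ n)) \<longlonglongrightarrow> V" .
  have "M \<longlonglongrightarrow> V"
  proof (rule tendsto_sandwich[OF _ _ L U])
    show "\<forall>\<^sub>F N in sequentially. L N \<le> M N"
      using lower by (rule eventually_sequentiallyI)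
    show "\<forall>\<^sub>F N in sequentially.
        M N \<le> layered_const a ls / (\<Prod>l\<leftarrow>ls. fact l) / (real (N choose n) / real N ^ n)"
      by (intro always_eventually allI upper)
  qed
  then have "packing_density n \<sigma> = V"
    unfolding packing_density_def M_def[symmetric] by (rule limI)
  then show ?thesis by (simp only: V_def es_def)
qed

theorem mainTheorem1:
  fixes a k n :: nat and l :: "nat \<Rightarrow> nat" and \<sigma> :: "nat \<Rightarrow> nat"
  assumes "k \<ge> 1"
    and "2 \<le> a"
    and "a \<le> l 1"
    and "\<And>i. 1 \<le> i \<Longrightarrow> i < k \<Longrightarrow> l i \<le> l (i + 1)"
    and "2 ^ a - int a - 1 \<ge> int k"
    and "has_layer_sequence \<sigma> (replicate a 1 @ map l [1..<k + 1])"
    and "n = a + (\<Sum>i = 1..k. l i)"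
  shows "packing_density n \<sigma> =
           fact n / real n ^ n * (real a ^ a / fact a) *
           (\<Prod>i = 1..k. real (l i) ^ l i / fact (l i))"
proof -
  define ls where "ls = map l [1..<k + 1]"
  have len: "length ls = k" by (simp add: ls_def del: upt_Suc)
  have nth: "ls ! i = l (Suc i)" if "i < k" for i
    using that by (simp add: ls_def del: upt_Suc)
  have sorted: "sorted ls"
    unfolding sorted_iff_nth_Suc using assms(4) len by (auto simp: nth)
  have ge: "a \<le> e" if e: "e \<in> set ls" for e
  proof -
    obtain i where i: "i < k" "e = ls ! i" using e len by (auto simp: in_set_conv_nth)
    then have "ls ! 0 \<le> e" using sorted len by (auto intro: sorted_nth_mono)
    then show ?thesis using nth[of 0] assms(1,3) by simp
  qed
  have "real_of_int (int k) \<le> real_of_int (2 ^ a - int a - 1)"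
    using assms(5) by (simp only: of_int_le_iff)
  then have bound: "real (length ls) \<le> 2 ^ a - real a - 1" by (simp add: len)
  have sets: "set [1..<k + 1] = {1..k}" by auto
  have "sum_list ls = (\<Sum>i = 1..k. l i)"
    unfolding ls_def by (simp only: sum.distinct_set_conv_list[OF distinct_upt, symmetric] sets)
  then have n: "n = a + sum_list ls" using assms(7) by simp
  have "(\<Prod>e\<leftarrow>ls. real e ^ e / fact e) = (\<Prod>i\<leftarrow>[1..<k + 1]. real (l i) ^ l i / fact (l i))"
    unfolding ls_def by (simp only: map_map o_def)
  also have "\<dots> = (\<Prod>i = 1..k. real (l i) ^ l i / fact (l i))"
    by (simp only: prod.distinct_set_conv_list[OF distinct_upt, symmetric] sets)
  finally have prod: "(\<Prod>e\<leftarrow>ls. real e ^ e / fact e) = (\<Prod>i = 1..k. real (l i) ^ l i / fact (l i))" .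
  have "ls \<noteq> []" using len assms(1) by auto
  then show ?thesis
    using packing_density_layered[OF _ sorted assms(2) ge bound assms(6)[folded ls_def]]
    by (simp add: n[symmetric] prod)
qed

end
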